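(* Let $M$ be a complex manifold and $L_{\mathbb{R}}$ a trivial real line bundle on $M$ with flat connection $d-\theta$, where $\theta$ is a real closed 1-form. Denote by $L$ its complexification, and let $\mathcal{L}$ be the underlying holomorphic line bundle. Then the sequence $$H^1(\mathcal{L})\oplus\overline{H^1(\mathcal{L})}\xrightarrow{\ \partial+\bar\partial\ }H^{1,1}_{\partial\bar\partial}(M,L)\xrightarrow{\ \nu\ }H^2_\theta(M)$$ is exact (at the middle term), where $\nu$ is the tautological map sending the Bott–Chern class of a form to its Morse–Novikov class, and the first arrow sends $([\alpha],[\beta])$ to $[\partial\alpha]+[\bar\partial\beta]$.
   Context: Using the trivialization of $L$, $L$-valued forms are complex-valued forms on $M$, and the connection acts as $d_\theta\eta=d\eta-\theta\wedge\eta$, with $(1,0)$- and $(0,1)$-parts $\partial=\partial_\theta$ (the usual $\partial$ minus $\theta^{1,0}\wedge$) and $\bar\partial=\bar\partial_\theta$ (the usual $\bar\partial$ minus $\theta^{0,1}\wedge$). The holomorphic structure of $\mathcal{L}$ is given by $\bar\partial_\theta$. $H^1(\mathcal{L})$ is the holomorphic cohomology of $\mathcal{L}$, computed as the first cohomology of the complex $C^\infty(L)\xrightarrow{\bar\partial_\theta}\Lambda^{0,1}(M,L)\xrightarrow{\bar\partial_\theta}\Lambda^{0,2}(M,L)\to\cdots$. Since $L$ is the complexification of a real flat bundle, $\overline{H^1(\mathcal{L})}$ is identified with the first cohomology of $C^\infty(L)\xrightarrow{\partial_\theta}\Lambda^{1,0}(M,L)\xrightarrow{\partial_\theta}\Lambda^{2,0}(M,L)\to\cdots$.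 In the claim, $\alpha\in\Lambda^{0,1}(M,L)$ with $\bar\partial_\theta\alpha=0$ represents a class in $H^1(\mathcal{L})$, and $\beta\in\Lambda^{1,0}(M,L)$ with $\partial_\theta\beta=0$ represents a class in $\overline{H^1(\mathcal{L})}$. The Bott–Chern cohomology with coefficients in $L$ is $$H^{1,1}_{\partial\bar\partial}(M,L)=\frac{\{\eta\in\Lambda^{1,1}(M,L):\ \partial_\theta\eta=0,\ \bar\partial_\theta\eta=0\}}{\partial_\theta\bar\partial_\theta\big(C^\infty(L)\big)}.$$ $H^2_\theta(M)$ is the Morse–Novikov cohomology: the second cohomology of the complex of complex-valued forms $(\Lambda^*(M),d_\theta)$. *)

theory Defs
  imports "HOL-Analysis.Analysis" "HOL-Algebra.Coset" "HOL-Library.Function_Algebras"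
begin

section \<open>Smooth and holomorphic maps\<close>

text \<open>On a finite-dimensional space, a map is of class $C^{k+1}$ on an open set iff it is
  differentiable there and all its directional derivatives are of class $C^k$.\<close>

fun Ck_on :: "nat \<Rightarrow> ('e::real_normed_vector \<Rightarrow> 'b::real_normed_vector) \<Rightarrow> 'e set \<Rightarrow> bool" where
  "Ck_on 0 f S \<longleftrightarrow> continuous_on S f"
| "Ck_on (Suc k) f S \<longleftrightarrow>
     (\<forall>x\<in>S. f differentiable (at x)) \<and> (\<forall>v. Ck_on k (\<lambda>x. frechet_derivative f (at x) v) S)"

definition smooth_on :: "('e::real_normed_vector \<Rightarrow> 'b::real_normed_vector) \<Rightarrow> 'e set \<Rightarrow> bool" where
  "smooth_on f S \<longleftrightarrow> (\<forall>k. Ck_on k f S)"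

text \<open>Holomorphy in several variables (for open \<open>S\<close>): complex differentiability at every point.\<close>

definition holomorphic_map_on :: "(complex ^ 'n \<Rightarrow> complex ^ 'm) \<Rightarrow> (complex ^ 'n) set \<Rightarrow> bool" where
  "holomorphic_map_on f S \<longleftrightarrow>
     (\<forall>x\<in>S. \<exists>A. (f has_derivative A) (at x) \<and> (\<forall>a v. A (a *s v) = a *s A v))"


section \<open>Complex manifolds\<close>

text \<open>A chart \<open>(U, \<phi>)\<close> has domain \<open>U\<close>; the values of \<open>\<phi>\<close> outside \<open>U\<close> are irrelevant.\<close>

type_synonym ('a, 'n) chart = "'a set \<times> ('a \<Rightarrow> complex ^ 'n)"

definition chart_image :: "('a, 'n) chart \<Rightarrow> (complex ^ 'n) set" where
  "chart_image c = snd c ` fst c"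

definition transition :: "('a, 'n) chart \<Rightarrow> ('a, 'n) chart \<Rightarrow> complex ^ 'n \<Rightarrow> complex ^ 'n" where
  "transition c d = snd d \<circ> inv_into (fst c) (snd c)"

definition complex_manifold :: "'a topology \<Rightarrow> ('a, 'n::finite) chart set \<Rightarrow> bool" where
  "complex_manifold X \<A> \<longleftrightarrow>
     Hausdorff_space X \<and> second_countable X \<and>
     (\<Union>c\<in>\<A>. fst c) = topspace X \<and>
     (\<forall>c\<in>\<A>. openin X (fst c) \<and> open (chart_image c) \<and>
        homeomorphic_map (subtopology X (fst c)) (top_of_set (chart_image c)) (snd c)) \<and>
     (\<forall>c\<in>\<A>. \<forall>d\<in>\<A>. holomorphic_map_on (transition c d) (snd c ` (fst c \<inter> fst d)))"


section \<open>Complex-valued differential forms\<close>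

text \<open>A form is given by its coordinate expressions: \<open>\<omega> c x [v\<^sub>1, \<dots>, v\<^sub>k]\<close> is the value,
  on the tangent vectors with coordinates \<open>v\<^sub>1, \<dots>, v\<^sub>k\<close>, of \<open>\<omega>\<close> at the point with coordinate \<open>x\<close>
  in the chart \<open>c\<close>. The expressions in different charts are related by pullback along the
  transition maps. Values at meaningless arguments (\<open>c\<close> not in the atlas, \<open>x\<close> outside the image
  of \<open>c\<close>, wrong number of vectors) are \<open>0\<close>, so that equality of forms is equality of functions.\<close>

type_synonym ('a, 'n) form =
  "('a, 'n) chart \<Rightarrow> complex ^ 'n \<Rightarrow> (complex ^ 'n) list \<Rightarrow> complex"

definition alternating_multilinear :: "nat \<Rightarrow> ((complex ^ 'n::finite) list \<Rightarrow> complex) \<Rightarrow> bool" where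
  "alternating_multilinear k h \<longleftrightarrow>
     (\<forall>vs. length vs \<noteq> k \<longrightarrow> h vs = 0) \<and>
     (\<forall>vs i. length vs = k \<and> i < k \<longrightarrow> linear (\<lambda>v. h (vs[i := v]))) \<and>
     (\<forall>vs i j. length vs = k \<and> i < j \<and> j < k \<and> vs ! i = vs ! j \<longrightarrow> h vs = 0)"

definition forms :: "('a, 'n::finite) chart set \<Rightarrow> nat \<Rightarrow> ('a, 'n) form set" where
  "forms \<A> k = {\<omega>.
     (\<forall>c x vs. c \<notin> \<A> \<or> x \<notin> chart_image c \<longrightarrow> \<omega> c x vs = 0) \<and>
     (\<forall>c\<in>\<A>. \<forall>x\<in>chart_image c. alternating_multilinear k (\<omega> c x)) \<and>
     (\<forall>c\<in>\<A>. \<forall>vs. smooth_on (\<lambda>x. \<omega> c x vs) (chart_image c)) \<and>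
     (\<forall>c\<in>\<A>. \<forall>d\<in>\<A>. \<forall>p\<in>fst c \<inter> fst d. \<forall>vs.
        \<omega> c (snd c p) vs =
        \<omega> d (snd d p) (map (frechet_derivative (transition c d) (at (snd c p))) vs))}"

text \<open>If \<open>A v\<close> is an alternating \<open>k\<close>-form for every \<open>v\<close>, linearly in \<open>v\<close>, then \<open>alt_sum A\<close> is the
  \<open>(k+1)\<close>-form $(v_0,\dots,v_k) \mapsto \sum_i (-1)^i A(v_i)(v_0,\dots,\widehat{v_i},\dots,v_k)$.
  Both $\xi\wedge\eta$ for a covector $\xi$ and $d\eta$ in coordinates are of this shape.\<close>

definition alt_sum :: "('e \<Rightarrow> 'e list \<Rightarrow> complex) \<Rightarrow> 'e list \<Rightarrow> complex" where
  "alt_sum A vs = (\<Sum>i<length vs. (- 1) ^ i * A (vs ! i) (take i vs @ drop (Suc i) vs))"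

text \<open>The wedge product of a list of covectors.\<close>

primrec wedge_list :: "('e \<Rightarrow> complex) list \<Rightarrow> 'e list \<Rightarrow> complex" where
  "wedge_list [] = (\<lambda>vs. if vs = [] then 1 else 0)"
| "wedge_list (\<xi> # \<xi>s) = alt_sum (\<lambda>v ws. \<xi> v * wedge_list \<xi>s ws)"

text \<open>$dz_{i_1}\wedge\dots\wedge dz_{i_p}\wedge d\bar z_{j_1}\wedge\dots\wedge d\bar z_{j_q}$\<close>

definition dz_dzbar :: "'n list \<Rightarrow> 'n list \<Rightarrow> (complex ^ 'n::finite) list \<Rightarrow> complex" where
  "dz_dzbar I J = wedge_list (map (\<lambda>i v. v $ i) I @ map (\<lambda>j v. cnj (v $ j)) J)"

definition pq_forms :: "('a, 'n::finite) chart set \<Rightarrow> nat \<Rightarrow> nat \<Rightarrow> ('a, 'n) form set" where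
  "pq_forms \<A> p q = {\<omega> \<in> forms \<A> (p + q). \<forall>c\<in>\<A>. \<forall>x\<in>chart_image c. \<exists>a. \<forall>vs.
     \<omega> c x vs = (\<Sum>I | length I = p. \<Sum>J | length J = q. a I J * dz_dzbar I J vs)}"


section \<open>The operators\<close>

text \<open>The complex linear and antilinear parts of a real linear functional, i.e. its
  \<open>(1,0)\<close>- and \<open>(0,1)\<close>-parts.\<close>

definition part10 :: "(complex ^ 'n \<Rightarrow> complex) \<Rightarrow> complex ^ 'n \<Rightarrow> complex" where
  "part10 \<xi> v = (\<xi> v - \<i> * \<xi> (\<i> *s v)) / 2"

definition part01 :: "(complex ^ 'n \<Rightarrow> complex) \<Rightarrow> complex ^ 'n \<Rightarrow> complex" where
  "part01 \<xi> v = (\<xi> v + \<i> * \<xi> (\<i> *s v)) / 2"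

text \<open>For \<open>P\<close> the identity, \<open>part10\<close>, \<open>part01\<close> this is the usual $d$, $\partial$, $\bar\partial$:
  if $\omega = \sum_{I,J} f_{IJ}\, dz_I\wedge d\bar z_J$ in a chart, then
  \<open>diff_op P \<omega>\<close> is $\sum_{I,J} P(df_{IJ})\wedge dz_I\wedge d\bar z_J$.\<close>

definition diff_op ::
  "((complex ^ 'n::finite \<Rightarrow> complex) \<Rightarrow> complex ^ 'n \<Rightarrow> complex) \<Rightarrow> ('a, 'n) form \<Rightarrow> ('a, 'n) form"
where
  "diff_op P \<omega> c x =
     (if x \<in> chart_image c
      then alt_sum (\<lambda>v ws. P (frechet_derivative (\<lambda>y. \<omega> c y ws) (at x)) v)
      else (\<lambda>vs. 0))"

definition ext_d :: "('a, 'n::finite) form \<Rightarrow> ('a, 'n) form" where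
  "ext_d = diff_op (\<lambda>\<xi>. \<xi>)"

definition wedge1 ::
  "(('a, 'n::finite) chart \<Rightarrow> complex ^ 'n \<Rightarrow> complex ^ 'n \<Rightarrow> complex) \<Rightarrow> ('a, 'n) form \<Rightarrow> ('a, 'n) form"
where
  "wedge1 \<xi> \<omega> c x = alt_sum (\<lambda>v ws. \<xi> c x v * \<omega> c x ws)"

definition d_theta :: "('a, 'n::finite) form \<Rightarrow> ('a, 'n) form \<Rightarrow> ('a, 'n) form" where
  "d_theta \<theta> \<omega> = ext_d \<omega> - wedge1 (\<lambda>c x v. \<theta> c x [v]) \<omega>"

definition del_theta :: "('a, 'n::finite) form \<Rightarrow> ('a, 'n) form \<Rightarrow> ('a, 'n) form" where
  "del_theta \<theta> \<omega> = diff_op part10 \<omega> - wedge1 (\<lambda>c x. part10 (\<lambda>v. \<theta> c x [v])) \<omega>"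

definition delbar_theta :: "('a, 'n::finite) form \<Rightarrow> ('a, 'n) form \<Rightarrow> ('a, 'n) form" where
  "delbar_theta \<theta> \<omega> = diff_op part01 \<omega> - wedge1 (\<lambda>c x. part01 (\<lambda>v. \<theta> c x [v])) \<omega>"


section \<open>Cohomology groups\<close>

text \<open>A set of forms as a group under pointwise addition.\<close>

definition form_group :: "('a, 'n::finite) form set \<Rightarrow> ('a, 'n) form monoid" where
  "form_group Z = \<lparr>carrier = Z, mult = (+), one = 0\<rparr>"

text \<open>The map sending the class of \<open>z\<close> to the class of \<open>f z\<close> modulo \<open>N\<close>. It is the union
  of the cosets of all \<open>f z\<close> with \<open>z\<close> in the given class; this is a single coset iff the
  map is well defined on that class.\<close>

definition induced_map ::
  "('a, 'n::finite) form set \<Rightarrow> ('a, 'n) form set \<Rightarrow> (('a, 'n) form \<Rightarrow> ('a, 'n) form) \<Rightarrow>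
   ('a, 'n) form set \<Rightarrow> ('a, 'n) form set"
where
  "induced_map Z N f K = (\<Union>z\<in>K. N #>\<^bsub>form_group Z\<^esub> f z)"

definition H1_hol ::
  "('a, 'n::finite) chart set \<Rightarrow> ('a, 'n) form \<Rightarrow> ('a, 'n) form set monoid" where
  "H1_hol \<A> \<theta> = form_group {\<alpha> \<in> pq_forms \<A> 0 1. delbar_theta \<theta> \<alpha> = 0}
                  Mod (delbar_theta \<theta> ` forms \<A> 0)"

definition H1_hol_conj ::
  "('a, 'n::finite) chart set \<Rightarrow> ('a, 'n) form \<Rightarrow> ('a, 'n) form set monoid" where
  "H1_hol_conj \<A> \<theta> = form_group {\<beta> \<in> pq_forms \<A> 1 0. del_theta \<theta> \<beta> = 0}
                       Mod (del_theta \<theta> ` forms \<A> 0)"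

definition BC_cocycles :: "('a, 'n::finite) chart set \<Rightarrow> ('a, 'n) form \<Rightarrow> ('a, 'n) form set" where
  "BC_cocycles \<A> \<theta> = {\<eta> \<in> pq_forms \<A> 1 1. del_theta \<theta> \<eta> = 0 \<and> delbar_theta \<theta> \<eta> = 0}"

definition BC_coboundaries :: "('a, 'n::finite) chart set \<Rightarrow> ('a, 'n) form \<Rightarrow> ('a, 'n) form set" where
  "BC_coboundaries \<A> \<theta> = (\<lambda>f. del_theta \<theta> (delbar_theta \<theta> f)) ` forms \<A> 0"

definition H11_BC ::
  "('a, 'n::finite) chart set \<Rightarrow> ('a, 'n) form \<Rightarrow> ('a, 'n) form set monoid" where
  "H11_BC \<A> \<theta> = form_group (BC_cocycles \<A> \<theta>) Mod BC_coboundaries \<A> \<theta>"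

definition MN_cocycles :: "('a, 'n::finite) chart set \<Rightarrow> ('a, 'n) form \<Rightarrow> ('a, 'n) form set" where
  "MN_cocycles \<A> \<theta> = {\<omega> \<in> forms \<A> 2. d_theta \<theta> \<omega> = 0}"

definition MN_coboundaries :: "('a, 'n::finite) chart set \<Rightarrow> ('a, 'n) form \<Rightarrow> ('a, 'n) form set" where
  "MN_coboundaries \<A> \<theta> = d_theta \<theta> ` forms \<A> 1"

definition H2_MN ::
  "('a, 'n::finite) chart set \<Rightarrow> ('a, 'n) form \<Rightarrow> ('a, 'n) form set monoid" where
  "H2_MN \<A> \<theta> = form_group (MN_cocycles \<A> \<theta>) Mod MN_coboundaries \<A> \<theta>"

definition del_plus_delbar ::
  "('a, 'n::finite) chart set \<Rightarrow> ('a, 'n) form \<Rightarrow>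
   ('a, 'n) form set \<times> ('a, 'n) form set \<Rightarrow> ('a, 'n) form set"
where
  "del_plus_delbar \<A> \<theta> = (\<lambda>(a, b).
     induced_map (BC_cocycles \<A> \<theta>) (BC_coboundaries \<A> \<theta>) (del_theta \<theta>) a
     \<otimes>\<^bsub>H11_BC \<A> \<theta>\<^esub>
     induced_map (BC_cocycles \<A> \<theta>) (BC_coboundaries \<A> \<theta>) (delbar_theta \<theta>) b)"

definition nu ::
  "('a, 'n::finite) chart set \<Rightarrow> ('a, 'n) form \<Rightarrow> ('a, 'n) form set \<Rightarrow> ('a, 'n) form set" where
  "nu \<A> \<theta> = induced_map (MN_cocycles \<A> \<theta>) (MN_coboundaries \<A> \<theta>) (\<lambda>\<eta>. \<eta>)"

end

theory Submission
  imports Defs "HOL-Complex_Analysis.Complex_Analysis"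
begin

text \<open>In a chart, the operators $d_\theta$, $\partial_\theta$, $\bar\partial_\theta$ are alternating sums of
  covariant derivatives in constant directions, and the latter commute because \<open>\<theta>\<close> is closed. Hence
  any two of the operators anticommute, so that $\partial_\theta^2 = \bar\partial_\theta^2 = 0$ and
  $\bar\partial_\theta\partial_\theta = -\partial_\theta\bar\partial_\theta$. If a \<open>(1,1)\<close>-form \<open>\<eta>\<close> equals
  $d_\theta\gamma$, split $\gamma = \beta + \alpha$ into its \<open>(1,0)\<close>- and \<open>(0,1)\<close>-parts: comparing types gives
  $\partial_\theta\beta = 0$, $\bar\partial_\theta\alpha = 0$ and
  $\eta = \partial_\theta\alpha + \bar\partial_\theta\beta$. The operators preserve the pullback relation between
  charts because transition maps are twice complex differentiable, by Cauchy's formula on complex lines.\<close>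

text \<open>The three operators are members of one family \<open>conn a b\<close>, so compatibility
  with charts, additivity and anticommutation are each proved once, for arbitrary parameters. The
  obstacle is that forms are families of coordinate expressions: the operators must be shown to
  respect the transition maps, of which the atlas only says that they have a complex linear
  derivative at each point. For functions this is enough, but in the derivative of a 1-form the
  second derivative of the transition map appears. It drops out because it exists, is symmetric and
  is complex linear, the last being needed since the operators also differentiate along
  \<open>\<i> *s v\<close>. Hence Cauchy's formula, and a symmetry theorem for mixed derivatives
  that does not presuppose their continuity. Derivatives of 2-forms are never placed in
  \<open>forms \<A> 3\<close>; they enter only through identities between functions. Bidegree is
  tracked by the effect of multiplying arguments by \<i>; the coefficients with respect to
  \<open>dz_dzbar\<close> appear only where this is matched with \<open>pq_forms\<close>.\<close>

section \<open>Smooth functions\<close>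

abbreviation dir_deriv :: "'e::real_normed_vector \<Rightarrow> ('e \<Rightarrow> 'b::real_normed_vector) \<Rightarrow> 'e \<Rightarrow> 'b" where
  "dir_deriv v f x \<equiv> frechet_derivative f (at x) v"

text \<open>\<open>frechet_derivative\<close> chooses among all derivatives, and both functions
  admit the same ones at \<open>x\<close>; this covers points where there are none.\<close>

lemma frechet_derivative_cong_open:
  assumes "open S" "x \<in> S" "\<And>y. y \<in> S \<Longrightarrow> f y = g y"
  shows "frechet_derivative f (at x) = frechet_derivative g (at x)"
proof -
  have "(f has_derivative A) (at x) = (g has_derivative A) (at x)" for A
    using has_derivative_transform_within_open[OF _ assms(1,2)] assms(3) by metis
  thus ?thesis by (simp add: frechet_derivative_def)
qed

lemma differentiable_cong_open:
  assumes "open S" "x \<in> S" "\<And>y. y \<in> S \<Longrightarrow> f y = g y" "f differentiable (at x)"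
  shows "g differentiable (at x)"
  using assms has_derivative_transform_within_open[OF _ assms(1,2)] unfolding differentiable_def by metis

lemma dir_deriv_eqI: "(f has_derivative A) (at x) \<Longrightarrow> dir_deriv v f x = A v"
  using frechet_derivative_at by metis

lemma dir_deriv_add:
  "\<lbrakk>f differentiable (at x); g differentiable (at x)\<rbrakk>
    \<Longrightarrow> dir_deriv v (\<lambda>y. f y + g y) x = dir_deriv v f x + dir_deriv v g x"
  by (intro dir_deriv_eqI has_derivative_add) (auto simp: frechet_derivative_works)

lemma Ck_on_cong:
  assumes "open S" "\<And>x. x \<in> S \<Longrightarrow> f x = g x" "Ck_on k f S"
  shows "Ck_on k g S"
  using assms(2,3)
proof (induction k arbitrary: f g)
  case 0
  then show ?case using continuous_on_cong[of S S f g] by auto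
next
  case (Suc k)
  have "Ck_on k (dir_deriv v g) S" for v
    using Suc.IH[of "dir_deriv v f" "dir_deriv v g"] Suc.prems
      frechet_derivative_cong_open[OF assms(1), of _ f g] by auto
  moreover have "g differentiable (at x)" if "x \<in> S" for x
    using Suc.prems differentiable_cong_open[OF assms(1) that] that by auto
  ultimately show ?case by auto
qed

lemma Ck_on_Suc_imp:
  assumes "Ck_on (Suc k) f S"
  shows "Ck_on k f S"
  using assms
proof (induction k arbitrary: f)
  case 0
  then show ?case
    by (auto intro!: continuous_at_imp_continuous_on differentiable_imp_continuous_within)
qed auto

lemma Ck_on_const: "Ck_on k (\<lambda>x. c) S"
  by (induction k arbitrary: c) auto

lemma Ck_on_add:
  assumes "open S" "Ck_on k f S" "Ck_on k g S"
  shows "Ck_on k (\<lambda>x. f x + g x) S"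
  using assms(2,3)
proof (induction k arbitrary: f g)
  case 0
  then show ?case by (auto intro: continuous_on_add)
next
  case (Suc k)
  have "Ck_on k (dir_deriv v (\<lambda>x. f x + g x)) S" for v
    by (rule Ck_on_cong[OF assms(1) _ Suc.IH[of "dir_deriv v f" "dir_deriv v g"]])
      (use Suc.prems in \<open>auto simp: dir_deriv_add\<close>)
  then show ?case using Suc.prems by auto
qed

lemma Ck_on_mult:
  fixes f g :: "'e::real_normed_vector \<Rightarrow> 'b::real_normed_algebra"
  assumes "open S" "Ck_on k f S" "Ck_on k g S"
  shows "Ck_on k (\<lambda>x. f x * g x) S"
  using assms(2,3)
proof (induction k arbitrary: f g)
  case 0
  then show ?case by (auto intro: continuous_on_mult)
next
  case (Suc k)
  have "dir_deriv v (\<lambda>x. f x * g x) x = f x * dir_deriv v g x + dir_deriv v f x * g x"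
    if "x \<in> S" for x v
    using that Suc.prems
    by (intro dir_deriv_eqI has_derivative_mult) (auto simp: frechet_derivative_works)
  moreover have "Ck_on k (\<lambda>x. f x * dir_deriv v g x + dir_deriv v f x * g x) S" for v
    \<comment> \<open>The Leibniz rule also contains the undifferentiated factors, which the
      induction hypothesis needs in class \<open>k\<close> instead of \<open>Suc k\<close>.\<close>
    using Suc.prems Ck_on_Suc_imp[OF Suc.prems(1)] Ck_on_Suc_imp[OF Suc.prems(2)]
    by (intro Ck_on_add Suc.IH assms) auto
  ultimately have "Ck_on k (dir_deriv v (\<lambda>x. f x * g x)) S" for v
    using Ck_on_cong[OF assms(1), of "\<lambda>x. f x * dir_deriv v g x + dir_deriv v f x * g x"]
    by (metis (no_types, lifting))
  then show ?case using Suc.prems by auto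
qed

lemma smooth_on_cong:
  "\<lbrakk>open S; \<And>x. x \<in> S \<Longrightarrow> f x = g x; smooth_on f S\<rbrakk> \<Longrightarrow> smooth_on g S"
  unfolding smooth_on_def using Ck_on_cong by blast

lemma smooth_on_const: "smooth_on (\<lambda>x. c) S"
  by (simp add: smooth_on_def Ck_on_const)

lemma smooth_on_add:
  "\<lbrakk>open S; smooth_on f S; smooth_on g S\<rbrakk> \<Longrightarrow> smooth_on (\<lambda>x. f x + g x) S"
  by (simp add: smooth_on_def Ck_on_add)

lemma smooth_on_mult:
  fixes f g :: "'e::real_normed_vector \<Rightarrow> 'b::real_normed_algebra"
  shows "\<lbrakk>open S; smooth_on f S; smooth_on g S\<rbrakk> \<Longrightarrow> smooth_on (\<lambda>x. f x * g x) S"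
  by (simp add: smooth_on_def Ck_on_mult)

lemma smooth_on_uminus:
  fixes f :: "'e::real_normed_vector \<Rightarrow> 'b::real_normed_algebra_1"
  assumes "open S" "smooth_on f S"
  shows "smooth_on (\<lambda>x. - f x) S"
  using smooth_on_mult[OF assms(1) smooth_on_const[of "- 1"] assms(2)] by simp

lemma smooth_on_diff:
  fixes f g :: "'e::real_normed_vector \<Rightarrow> 'b::real_normed_algebra_1"
  assumes "open S" "smooth_on f S" "smooth_on g S"
  shows "smooth_on (\<lambda>x. f x - g x) S"
  using smooth_on_add[OF assms(1,2) smooth_on_uminus[OF assms(1,3)]] by simp

lemma smooth_on_dir_deriv: "smooth_on f S \<Longrightarrow> smooth_on (dir_deriv v f) S"
  unfolding smooth_on_def using Ck_on.simps(2) by blast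

lemma smooth_on_imp_differentiable: "\<lbrakk>smooth_on f S; x \<in> S\<rbrakk> \<Longrightarrow> f differentiable (at x)"
  unfolding smooth_on_def using Ck_on.simps(2) by blast

lemma smooth_on_has_derivative:
  "\<lbrakk>smooth_on f S; x \<in> S\<rbrakk> \<Longrightarrow> (f has_derivative (\<lambda>v. dir_deriv v f x)) (at x)"
  using smooth_on_imp_differentiable by (auto simp: frechet_derivative_works)

lemma dir_deriv_cmult:
  fixes f :: "'e::real_normed_vector \<Rightarrow> 'b::real_normed_algebra"
  shows "f differentiable (at x) \<Longrightarrow> dir_deriv v (\<lambda>y. c * f y) x = c * dir_deriv v f x"
  by (intro dir_deriv_eqI has_derivative_mult_right) (auto simp: frechet_derivative_works)

text \<open>The mixed second difference quotient in the directions \<open>v\<close>, \<open>w\<close> is symmetric in them.\<close>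

lemma second_difference_tendsto:
  fixes f :: "'e::real_normed_vector \<Rightarrow> 'b::real_normed_vector"
  assumes S: "open S" "x \<in> S" and f: "\<And>y. y \<in> S \<Longrightarrow> f differentiable (at y)"
    and g: "dir_deriv v f differentiable (at x)"
  shows "((\<lambda>h. (f (x + h *\<^sub>R v + h *\<^sub>R w) - f (x + h *\<^sub>R v) - f (x + h *\<^sub>R w) + f x) /\<^sub>R h\<^sup>2)
            \<longlongrightarrow> dir_deriv w (dir_deriv v f) x) (at_right 0)"
proof -
  define G where "G = dir_deriv v f"
  define A where "A = frechet_derivative G (at x)"
  have A: "(G has_derivative A) (at x)"
    using g by (simp add: G_def A_def frechet_derivative_works)
  interpret A: bounded_linear A using A by (rule has_derivative_bounded_linear)
  \<comment> \<open>\<open>h * N\<close> bounds the distance from \<open>x\<close> within the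
    parallelogram with sides \<open>h *\<^sub>R v\<close> and \<open>h *\<^sub>R w\<close>; the
    summand 1 keeps \<open>N\<close> positive.\<close>
  define N where "N = norm v + norm w + 1"
  have N: "N > 0" by (simp add: N_def add_nonneg_pos)
  show ?thesis
  proof (rule tendstoI)
    fix e :: real assume e: "e > 0"
    \<comment> \<open>Two remainder estimates will add up to the error \<open>2 * e' * N\<close>,
      which is two thirds of \<open>e\<close>.\<close>
    define e' where "e' = e / (3 * N)"
    have e': "e' > 0" using e N by (simp add: e'_def)
    obtain d1 where d1: "d1 > 0"
      "\<And>y. norm (y - x) < d1 \<Longrightarrow> norm (G y - G x - A (y - x)) \<le> e' * norm (y - x)"
      using A[unfolded has_derivative_at_alt] e' by blast
    obtain d2 where d2: "d2 > 0" "ball x d2 \<subseteq> S"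
      using S open_contains_ball by blast
    define d where "d = min d1 d2 / N"
    have d: "d > 0" using d1 d2 N by (simp add: d_def)
    have main: "dist ((f (x + h *\<^sub>R v + h *\<^sub>R w) - f (x + h *\<^sub>R v) - f (x + h *\<^sub>R w) + f x) /\<^sub>R h\<^sup>2) (A w) < e"
      if h: "0 < h" "h < d" for h
    proof -
      have hN: "h * N < min d1 d2" using h N by (simp add: d_def field_simps)
      have near: "norm ((x + s *\<^sub>R v + t *\<^sub>R w) - x) \<le> h * N" if "0 \<le> s" "s \<le> h" "0 \<le> t" "t \<le> h" for s t
      proof -
        have "norm ((x + s *\<^sub>R v + t *\<^sub>R w) - x) \<le> s * norm v + t * norm w"
          using norm_triangle_ineq[of "s *\<^sub>R v" "t *\<^sub>R w"] that by (simp add: algebra_simps)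
        also have "\<dots> \<le> h * norm v + h * norm w" using that by (intro add_mono mult_right_mono) auto
        also have "\<dots> \<le> h * N" using h by (simp add: N_def algebra_simps)
        finally show ?thesis .
      qed
      have inS: "x + s *\<^sub>R v + t *\<^sub>R w \<in> S" if "0 \<le> s" "s \<le> h" "0 \<le> t" "t \<le> h" for s t
        using near[OF that] hN d2(2) by (auto simp: dist_norm norm_minus_commute subset_iff)
      have est: "norm (G (x + s *\<^sub>R v + t *\<^sub>R w) - G x - A (s *\<^sub>R v + t *\<^sub>R w)) \<le> e' * (h * N)"
        if "0 \<le> s" "s \<le> h" "0 \<le> t" "t \<le> h" for s t
      proof -
        have "norm (G (x + s *\<^sub>R v + t *\<^sub>R w) - G x - A ((x + s *\<^sub>R v + t *\<^sub>R w) - x))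
           \<le> e' * norm ((x + s *\<^sub>R v + t *\<^sub>R w) - x)"
          using near[OF that] hN by (intro d1(2)) auto
        also have "\<dots> \<le> e' * (h * N)" using near[OF that] e' by (intro mult_left_mono) auto
        finally show ?thesis by (simp add: add.assoc)
      qed
      \<comment> \<open>The increment of \<open>f\<close> in direction \<open>w\<close>, seen as a
        function of the position \<open>s\<close> along \<open>v\<close>, less its expected linear
        growth. Then \<open>\<psi> h - \<psi> 0\<close> is the second difference minus
        \<open>h\<^sup>2 *\<^sub>R A w\<close>, and the mean value inequality bounds it through
        first derivatives of \<open>f\<close> alone.\<close>
      define \<psi> where "\<psi> s = f (x + s *\<^sub>R v + h *\<^sub>R w) - f (x + s *\<^sub>R v) - s *\<^sub>R (h *\<^sub>R A w)" for s
      define \<psi>' where "\<psi>' s = (\<lambda>r. r *\<^sub>R (G (x + s *\<^sub>R v + h *\<^sub>R w) - G (x + s *\<^sub>R v) - h *\<^sub>R A w))" for s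
      have fd: "((\<lambda>s. f (x + s *\<^sub>R v + t *\<^sub>R w)) has_derivative (\<lambda>r. r *\<^sub>R G (x + s *\<^sub>R v + t *\<^sub>R w))) (at s within {0..h})"
        if "0 \<le> s" "s \<le> h" "0 \<le> t" "t \<le> h" for s t
      proof -
        let ?y = "x + s *\<^sub>R v + t *\<^sub>R w"
        have D: "(f has_derivative frechet_derivative f (at ?y)) (at ?y)"
          using f[OF inS[OF that]] by (simp add: frechet_derivative_works)
        have l: "linear (frechet_derivative f (at ?y))"
          using D has_derivative_linear by blast
        have "((\<lambda>s. x + s *\<^sub>R v + t *\<^sub>R w) has_derivative (\<lambda>r. r *\<^sub>R v)) (at s within {0..h})"
          by (auto intro!: derivative_eq_intros)
        from has_derivative_compose[OF this D]
        show ?thesis by (simp add: G_def linear_cmul[OF l])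
      qed
      have "norm (\<psi> h - \<psi> 0) \<le> (2 * (e' * (h * N))) * norm (h - 0)"
      proof (rule differentiable_bound[of "{0..h}" \<psi> \<psi>'])
        fix s assume s: "s \<in> {0..h}"
        \<comment> \<open>Inserting \<open>0 *\<^sub>R w\<close> lets \<open>fd\<close> apply to
          both terms, with \<open>t = h\<close> and \<open>t = 0\<close>; \<open>est\<close> is used
          in the same way below.\<close>
        have "((\<lambda>s. f (x + s *\<^sub>R v + h *\<^sub>R w) - f (x + s *\<^sub>R v + 0 *\<^sub>R w) - s *\<^sub>R (h *\<^sub>R A w)) has_derivative
          (\<lambda>r. r *\<^sub>R G (x + s *\<^sub>R v + h *\<^sub>R w) - r *\<^sub>R G (x + s *\<^sub>R v + 0 *\<^sub>R w) - r *\<^sub>R (h *\<^sub>R A w))) (at s within {0..h})"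
          using s h by (intro has_derivative_diff fd) (auto intro!: derivative_eq_intros)
        then show "(\<psi> has_derivative \<psi>' s) (at s within {0..h})"
          by (simp add: \<psi>_def[abs_def] \<psi>'_def scaleR_diff_right)
        have "norm (G (x + s *\<^sub>R v + h *\<^sub>R w) - G (x + s *\<^sub>R v) - h *\<^sub>R A w)
          = norm ((G (x + s *\<^sub>R v + h *\<^sub>R w) - G x - A (s *\<^sub>R v + h *\<^sub>R w)) - (G (x + s *\<^sub>R v + 0 *\<^sub>R w) - G x - A (s *\<^sub>R v + 0 *\<^sub>R w)))"
          by (simp add: A.add A.scaleR algebra_simps)
        also have "\<dots> \<le> e' * (h * N) + e' * (h * N)"
          by (rule order_trans[OF norm_triangle_ineq4 add_mono]; rule est) (use s h in auto)
        finally have *: "norm (G (x + s *\<^sub>R v + h *\<^sub>R w) - G (x + s *\<^sub>R v) - h *\<^sub>R A w) \<le> 2 * (e' * (h * N))" by linarith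
        show "onorm (\<psi>' s) \<le> 2 * (e' * (h * N))"
          unfolding \<psi>'_def
        proof (rule onorm_bound)
          show "norm (r *\<^sub>R (G (x + s *\<^sub>R v + h *\<^sub>R w) - G (x + s *\<^sub>R v) - h *\<^sub>R A w)) \<le> 2 * (e' * (h * N)) * norm r" for r
            using mult_left_mono[OF *, of "\<bar>r\<bar>"] by (simp add: mult.commute)
        qed (use e' h N in auto)
      qed (use h in auto)
      then have b: "norm (\<psi> h - \<psi> 0) \<le> (2 * e' * N) * h\<^sup>2"
        using h by (simp add: power2_eq_square algebra_simps)
      let ?q = "f (x + h *\<^sub>R v + h *\<^sub>R w) - f (x + h *\<^sub>R v) - f (x + h *\<^sub>R w) + f x"
      have eq: "?q /\<^sub>R h\<^sup>2 - A w = (\<psi> h - \<psi> 0) /\<^sub>R h\<^sup>2"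
        using h by (simp add: \<psi>_def power2_eq_square scaleR_diff_right scaleR_add_right field_simps)
      have "norm (?q /\<^sub>R h\<^sup>2 - A w) = norm (\<psi> h - \<psi> 0) / h\<^sup>2"
        unfolding eq by (simp add: divide_inverse_commute)
      also have "\<dots> \<le> 2 * e' * N" using b h by (simp add: divide_le_eq)
      also have "\<dots> < e" using e N by (simp add: e'_def field_simps)
      finally show ?thesis by (simp add: dist_norm)
    qed
    show "\<forall>\<^sub>F h in at_right 0. dist ((f (x + h *\<^sub>R v + h *\<^sub>R w) - f (x + h *\<^sub>R v) - f (x + h *\<^sub>R w) + f x) /\<^sub>R h\<^sup>2)
          (dir_deriv w (dir_deriv v f) x) < e"
      unfolding eventually_at_right_field using main d by (auto simp: A_def G_def)
  qed
qed

text \<open>Both iterated derivatives are limits of the same difference quotient, so uniqueness of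
  limits identifies them. Differentiability of the two first derivatives at the single point
  \<open>x\<close> is enough, which fits maps known only to be twice differentiable.\<close>

lemma dir_deriv_commute:
  fixes f :: "'e::real_normed_vector \<Rightarrow> 'b::real_normed_vector"
  assumes S: "open S" "x \<in> S" and f: "\<And>y. y \<in> S \<Longrightarrow> f differentiable (at y)"
    and g: "dir_deriv v f differentiable (at x)" "dir_deriv w f differentiable (at x)"
  shows "dir_deriv w (dir_deriv v f) x = dir_deriv v (dir_deriv w f) x"
proof -
  note * = second_difference_tendsto[OF S f]
  have eq: "x + h *\<^sub>R w + h *\<^sub>R v = x + h *\<^sub>R v + h *\<^sub>R w" for h by simp
  show ?thesis
    using *[OF _ g(1), of w] *[OF _ g(2), of v]
    by (intro tendsto_unique[OF trivial_limit_at_right_real]) (auto simp: eq algebra_simps)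
qed

lemma smooth_on_dir_deriv_commute:
  assumes "open S" "smooth_on f S" "x \<in> S"
  shows "dir_deriv w (dir_deriv v f) x = dir_deriv v (dir_deriv w f) x"
  using assms smooth_on_dir_deriv[OF assms(2)]
  by (intro dir_deriv_commute[of S]) (auto intro: smooth_on_imp_differentiable)

section \<open>Holomorphic maps in several variables\<close>

lemma norm_vector_scalar_mult: "norm (a *s v) = cmod a * norm (v :: complex ^ 'n::finite)"
  by (simp add: norm_vec_def L2_set_def norm_mult power_mult_distrib real_sqrt_mult flip: sum_distrib_left)

lemma bounded_bilinear_vector_scalar_mult:
  "bounded_bilinear (\<lambda>(a::complex) (v :: complex ^ 'n::finite). a *s v)"
proof
  show "\<exists>K. \<forall>a b. norm (a *s (b :: complex ^ 'n)) \<le> norm a * norm b * K"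
    by (intro exI[of _ 1]) (simp add: norm_vector_scalar_mult)
qed (auto simp: vec_eq_iff algebra_simps)

interpretation smult: bounded_bilinear "\<lambda>(a::complex) (v :: complex ^ 'n::finite). a *s v"
  by (rule bounded_bilinear_vector_scalar_mult)

text \<open>Cauchy's formula for the derivative along the complex line through \<open>x\<close> in direction \<open>v\<close>.\<close>

lemma derivative_eq_circle_integral:
  fixes g :: "complex ^ 'n::finite \<Rightarrow> complex"
  assumes g: "\<And>x. x \<in> S \<Longrightarrow> (g has_derivative G x) (at x)"
    and lin: "\<And>x a v. x \<in> S \<Longrightarrow> G x (a *s v) = a * G x v"
    and r: "r > 0" and S: "\<And>z. cmod z \<le> r \<Longrightarrow> x + z *s v \<in> S"
  shows "G x v = integral {0..1} (\<lambda>t. g (x + circlepath 0 (of_real r) t *s v) * inverse (circlepath 0 (of_real r) t))"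
proof -
  \<comment> \<open>The restriction to the complex line. By \<open>lin\<close> its real derivative
    is multiplication by \<open>G (x + z *s v) v\<close>, so \<open>h\<close> is complex
    differentiable.\<close>
  define h where "h z = g (x + z *s v)" for z
  have h: "(h has_field_derivative G (x + z *s v) v) (at z)" if "cmod z \<le> r" for z
  proof -
    have "((\<lambda>z. x + z *s v) has_derivative (\<lambda>y. y *s v)) (at z)"
      by (auto intro!: derivative_eq_intros smult.FDERIV)
    from has_derivative_compose[OF this g[OF S[OF that]]] lin[OF S[OF that]]
    show ?thesis by (simp add: h_def[abs_def] has_field_derivative_def mult_commute_abs)
  qed
  have "continuous_on (cball 0 r) h"
    using h by (auto intro!: continuous_at_imp_continuous_on DERIV_isCont)
  moreover have "h holomorphic_on ball 0 r"
    unfolding holomorphic_on_def field_differentiable_def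
    by (auto intro!: exI has_field_derivative_at_within[OF h])
  ultimately have "(h has_field_derivative (1 / (2 * of_real pi * \<i>) *
      contour_integral (circlepath 0 r) (\<lambda>u. h u / (u - 0)^2))) (at 0)"
    using r by (intro Cauchy_derivative_integral_circlepath) auto
  moreover have "(h has_field_derivative G x v) (at 0)" using h[of 0] r by simp
  ultimately have "G x v = 1 / (2 * of_real pi * \<i>) * contour_integral (circlepath 0 r) (\<lambda>u. h u / u^2)"
    using DERIV_unique by fastforce
  also have "\<dots> = integral {0..1} (\<lambda>t. 1 / (2 * of_real pi * \<i>) * (h (circlepath 0 r t) / (circlepath 0 r t)^2
      * vector_derivative (circlepath 0 r) (at t)))"
    unfolding contour_integral_integral by (subst integral_mult_right) simp
  \<comment> \<open>The velocity of the circle at \<open>c\<close> is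
    \<open>2 * pi * \<i> * c\<close>: it cancels the prefactor of Cauchy's formula and one of the
    two factors \<open>c\<close> in the denominator.\<close>
  also have "\<dots> = integral {0..1} (\<lambda>t. h (circlepath 0 r t) * inverse (circlepath 0 r t))"
  proof (rule integral_cong)
    fix t
    define c where "c = circlepath 0 r t"
    define k where "k = 2 * of_real pi * \<i>"
    have "vector_derivative (circlepath 0 r) (at t) = k * c"
      unfolding vector_derivative_circlepath c_def k_def by (simp add: circlepath)
    moreover have "c \<noteq> 0" using r by (simp add: c_def circlepath)
    moreover have "k \<noteq> 0" by (simp add: k_def)
    ultimately show "1 / (2 * of_real pi * \<i>) * (h (circlepath 0 r t) / (circlepath 0 r t)^2
      * vector_derivative (circlepath 0 r) (at t)) = h (circlepath 0 r t) * inverse (circlepath 0 r t)"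
      unfolding c_def[symmetric] k_def[symmetric] by (simp add: power2_eq_square) (simp add: divide_inverse)
  qed
  finally show ?thesis by (simp add: h_def)
qed

lemma continuous_on_circlepath: "continuous_on A (circlepath z r)"
  unfolding circlepath by (intro continuous_intros)

context
  fixes g :: "complex ^ 'n::finite \<Rightarrow> complex" and G S
  assumes S: "open S"
    and g: "\<And>x. x \<in> S \<Longrightarrow> (g has_derivative G x) (at x)"
    and lin: "\<And>x a v. x \<in> S \<Longrightarrow> G x (a *s v) = a * G x v"
begin

text \<open>One radius has to serve a whole ball of centres \<open>x\<close>: only then is the
  derivative a parameter integral over a fixed interval that can itself be differentiated in
  \<open>x\<close>.\<close>

lemma local_circle_integral:
  assumes "x0 \<in> S"
  obtains d r where "d > 0" "r > 0" "\<And>x z. x \<in> ball x0 d \<Longrightarrow> cmod z \<le> r \<Longrightarrow> x + z *s v \<in> S"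
    "\<And>x. x \<in> ball x0 d \<Longrightarrow> G x v =
      integral {0..1} (\<lambda>t. g (x + circlepath 0 (of_real r) t *s v) * inverse (circlepath 0 (of_real r) t))"
proof -
  obtain e where e: "e > 0" "ball x0 e \<subseteq> S" using S assms open_contains_ball by blast
  \<comment> \<open>Half of \<open>e\<close> is spent on moving the centre, half on the circle; the
    summand 1 covers \<open>v = 0\<close>.\<close>
  define r where "r = e / 2 / (norm v + 1)"
  have r: "r > 0" using e by (simp add: r_def add_nonneg_pos)
  have rv: "r * norm v \<le> e / 2"
  proof -
    have "norm v + 1 \<noteq> 0" using norm_ge_zero[of v] by linarith
    then have "r * (norm v + 1) = e / 2"
      unfolding r_def by (simp only: nonzero_eq_divide_eq times_divide_eq_left nonzero_mult_div_cancel_right not_False_eq_True)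
    then show ?thesis using r by (simp add: algebra_simps)
  qed
  have inS: "x + z *s v \<in> S" if "x \<in> ball x0 (e/2)" "cmod z \<le> r" for x z
  proof -
    have "norm (z *s v) \<le> e / 2"
      using mult_right_mono[OF that(2), of "norm v"] rv by (simp add: norm_vector_scalar_mult)
    then have "dist x0 (x + z *s v) < e"
      using that(1) dist_triangle[of x0 "x + z *s v" x] by (simp add: dist_norm)
    then show ?thesis using e by auto
  qed
  show ?thesis
  proof (rule that[of "e/2" r])
    show "G x v = integral {0..1} (\<lambda>t. g (x + circlepath 0 (of_real r) t *s v) * inverse (circlepath 0 (of_real r) t))"
      if "x \<in> ball x0 (e/2)" for x
      by (rule derivative_eq_circle_integral[OF g lin r inS]) (use that in auto)
  qed (use e r inS in auto)
qed

text \<open>\<open>F\<close> is arbitrary because joint continuity of the integrand is needed twice: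
  for \<open>g\<close>, and for the derivative of \<open>g\<close> in a fixed direction.\<close>

lemma continuous_on_circle_shift:
  fixes F :: "complex ^ 'n \<Rightarrow> complex"
  assumes "r > 0" "\<And>x z. x \<in> U \<Longrightarrow> cmod z \<le> r \<Longrightarrow> x + z *s v \<in> S" "continuous_on S F"
  shows "continuous_on (U \<times> cbox 0 1)
    (\<lambda>(x, t). F (x + circlepath 0 (of_real r) t *s v) * inverse (circlepath 0 (of_real r) t))"
proof -
  have n: "cmod (circlepath 0 (of_real r) t) = r" for t
    using assms by (simp add: circlepath norm_mult norm_exp_eq_Re)
  have nz: "circlepath 0 (of_real r) t \<noteq> 0" for t using n[of t] assms by auto
  have c: "continuous_on (U \<times> cbox 0 (1::real)) (\<lambda>p. circlepath 0 (of_real r) (snd p))"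
    by (intro continuous_on_compose2[OF continuous_on_circlepath[of UNIV]] continuous_intros) auto
  show ?thesis unfolding split_beta
    by (intro continuous_intros c smult.continuous_on continuous_on_compose2[OF assms(3)])
      (use assms(2) n nz in auto)
qed

text \<open>The circle integral involves only values of \<open>g\<close>, which is continuous, and a
  parameter integral of a continuous integrand is continuous. The Leibniz rule below depends on
  this.\<close>

lemma continuous_on_holomorphic_derivative: "continuous_on S (\<lambda>x. G x v)"
  unfolding continuous_on_eq_continuous_at[OF S]
proof
  fix x0 assume "x0 \<in> S"
  then obtain d r where dr: "d > 0" "r > 0" "\<And>x z. x \<in> ball x0 d \<Longrightarrow> cmod z \<le> r \<Longrightarrow> x + z *s v \<in> S"
    and G: "\<And>x. x \<in> ball x0 d \<Longrightarrow> G x v =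
      integral {0..1} (\<lambda>t. g (x + circlepath 0 (of_real r) t *s v) * inverse (circlepath 0 (of_real r) t))"
    by (rule local_circle_integral[where v = v]) blast
  have "continuous_on S g"
    using g by (auto intro!: continuous_at_imp_continuous_on has_derivative_continuous)
  then have "continuous_on (ball x0 d) (\<lambda>x. integral (cbox 0 1)
      (\<lambda>t. g (x + circlepath 0 (of_real r) t *s v) * inverse (circlepath 0 (of_real r) t)))"
    by (intro integral_continuous_on_param continuous_on_circle_shift) (use dr in auto)
  then have "continuous_on (ball x0 d) (\<lambda>x. G x v)"
    by (rule continuous_on_eq) (simp add: G)
  then show "isCont (\<lambda>x. G x v) x0"
    using dr by (simp add: continuous_on_eq_continuous_at)
qed

text \<open>Differentiation under the circle integral. The resulting derivative is an integral of
  complex linear maps \<open>G (x + c *s v)\<close>, divided by \<open>c\<close>, and therefore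
  complex linear again.\<close>

lemma holomorphic_derivative_differentiable:
  assumes "x0 \<in> S"
  shows "\<exists>A. ((\<lambda>x. G x v) has_derivative A) (at x0) \<and> (\<forall>a w. A (a *s w) = a * A w)"
proof -
  obtain d r where dr: "d > 0" "r > 0" "\<And>x z. x \<in> ball x0 d \<Longrightarrow> cmod z \<le> r \<Longrightarrow> x + z *s v \<in> S"
    and G: "\<And>x. x \<in> ball x0 d \<Longrightarrow> G x v =
      integral {0..1} (\<lambda>t. g (x + circlepath 0 (of_real r) t *s v) * inverse (circlepath 0 (of_real r) t))"
    using assms by (rule local_circle_integral[where v = v]) blast
  let ?c = "circlepath 0 (of_real r)"
  have n: "cmod (?c t) = r" for t using dr by (simp add: circlepath norm_mult norm_exp_eq_Re)
  have inS: "x + ?c t *s v \<in> S" if "x \<in> ball x0 d" for x t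
    using dr that n by auto
  \<comment> \<open>The Leibniz rule takes the derivative of the integrand as an element of the
    space of bounded linear maps, continuous in operator norm.\<close>
  define fx where "fx x t = Blinfun (\<lambda>w. G (x + ?c t *s v) w * inverse (?c t))" for x t
  have fx: "blinfun_apply (fx x t) = (\<lambda>w. G (x + ?c t *s v) w * inverse (?c t))" if "x \<in> ball x0 d" for x t
    unfolding fx_def
    by (intro bounded_linear_Blinfun_apply bounded_linear_compose[OF bounded_linear_mult_left]
        has_derivative_bounded_linear[OF g[OF inS[OF that]]])
  have cont_w: "continuous_on (ball x0 d \<times> cbox 0 1) (\<lambda>(x, t). blinfun_apply (fx x t) w)" for w
    by (rule continuous_on_eq[OF continuous_on_circle_shift[OF dr(2,3) continuous_on_holomorphic_derivative]])
      (auto simp: fx)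
  \<comment> \<open>In finite dimension, continuity at each fixed vector \<open>w\<close> gives
    continuity in operator norm.\<close>
  then have cont: "continuous_on (ball x0 d \<times> cbox 0 1) (\<lambda>(x, t). fx x t)"
    unfolding split_beta by (intro continuous_on_blinfun_componentwise)
  have int: "(\<lambda>t. fx x0 t) integrable_on cbox 0 1"
  proof (rule integrable_continuous)
    show "continuous_on (cbox 0 1) (fx x0)"
      using continuous_on_compose2[OF cont, of "cbox 0 1" "\<lambda>t. (x0, t)"] dr
      by (auto simp: image_subset_iff continuous_on_Pair[OF continuous_on_const continuous_on_id])
  qed
  let ?A = "blinfun_apply (integral (cbox 0 1) (fx x0))"
  have contg: "continuous_on S g"
    using g by (auto intro!: continuous_at_imp_continuous_on has_derivative_continuous)
  have "((\<lambda>x. integral (cbox 0 1) (\<lambda>t. g (x + ?c t *s v) * inverse (?c t))) has_derivative ?A) (at x0 within ball x0 d)"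
  proof (rule leibniz_rule[OF _ _ cont])
    fix x t assume x: "x \<in> ball x0 d" "t \<in> cbox 0 (1::real)"
    have "((\<lambda>x. x + ?c t *s v) has_derivative (\<lambda>w. w)) (at x within ball x0 d)"
      by (auto intro!: derivative_eq_intros)
    from has_derivative_compose[OF this g[OF inS[OF x(1)]]]
    show "((\<lambda>x. g (x + ?c t *s v) * inverse (?c t)) has_derivative blinfun_apply (fx x t)) (at x within ball x0 d)"
      unfolding fx[OF x(1)] by (intro has_derivative_mult_left)
  next
    fix x assume x: "x \<in> ball x0 d"
    show "(\<lambda>t. g (x + ?c t *s v) * inverse (?c t)) integrable_on cbox 0 1"
    proof (rule integrable_continuous)
      show "continuous_on (cbox 0 1) (\<lambda>t. g (x + ?c t *s v) * inverse (?c t))"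
        using continuous_on_compose2[OF continuous_on_circle_shift[where U = "ball x0 d", OF dr(2,3) contg], of "cbox 0 1" "\<lambda>t. (x, t)"] x
        by (auto simp: image_subset_iff continuous_on_Pair[OF continuous_on_const continuous_on_id])
    qed
  qed (use dr in auto)
  then have "((\<lambda>x. G x v) has_derivative ?A) (at x0 within ball x0 d)"
    by (rule has_derivative_transform[rotated 2]) (use dr in \<open>auto simp: G\<close>)
  then have "((\<lambda>x. G x v) has_derivative ?A) (at x0)"
    using dr at_within_open[of x0 "ball x0 d"] by simp
  moreover have "?A (a *s w) = a * ?A w" for a w
  proof -
    have "?A w' = integral {0..1} (\<lambda>t. G (x0 + ?c t *s v) w' * inverse (?c t))" for w'
      using dr blinfun_apply_integral[OF int, of w'] by (simp add: fx)
    then show ?thesis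
      using dr lin[OF inS] by (simp add: mult.assoc)
  qed
  ultimately show ?thesis by blast
qed

end

lemma holomorphic_map_on_has_derivative:
  assumes "holomorphic_map_on f S" "x \<in> S"
  shows "(f has_derivative (\<lambda>v. dir_deriv v f x)) (at x)"
  using assms unfolding holomorphic_map_on_def
  by (metis differentiableI frechet_derivative_works)

lemma holomorphic_map_on_dir_deriv_smult:
  assumes "holomorphic_map_on f S" "x \<in> S"
  shows "dir_deriv (a *s v) f x = a *s dir_deriv v f x"
  using assms unfolding holomorphic_map_on_def by (metis dir_deriv_eqI)

text \<open>Cauchy's formula was used for scalar functions, so the components are treated separately
  and their derivatives reassembled.\<close>

lemma holomorphic_map_on_dir_deriv:
  fixes f :: "complex ^ 'n::finite \<Rightarrow> complex ^ 'm::finite"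
  assumes S: "open S" and f: "holomorphic_map_on f S"
  shows "holomorphic_map_on (dir_deriv v f) S"
  unfolding holomorphic_map_on_def
proof
  fix x assume x: "x \<in> S"
  have "\<exists>A. ((\<lambda>x. dir_deriv v f x $ j) has_derivative A) (at x) \<and> (\<forall>a w. A (a *s w) = a * A w)" for j
  proof (rule holomorphic_derivative_differentiable[OF S _ _ x])
    show "((\<lambda>x. f x $ j) has_derivative (\<lambda>v. dir_deriv v f y $ j)) (at y)" if "y \<in> S" for y
      by (rule bounded_linear.has_derivative[OF bounded_linear_vec_nth
            holomorphic_map_on_has_derivative[OF f that]])
    show "dir_deriv (a *s v) f y $ j = a * dir_deriv v f y $ j" if "y \<in> S" for y a v
      using holomorphic_map_on_dir_deriv_smult[OF f that] by simp
  qed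
  then obtain A where A: "\<And>j. ((\<lambda>x. dir_deriv v f x $ j) has_derivative A j) (at x)"
    "\<And>j a w. A j (a *s w) = a * A j w" by metis
  \<comment> \<open>The real basis vectors are \<open>axis j b\<close> with \<open>b\<close> in the
    real basis of the complex numbers, so each real component is an inner product with one complex
    component.\<close>
  have "(dir_deriv v f has_derivative (\<lambda>w. \<chi> j. A j w)) (at x)"
    using A(1) by (subst has_derivative_componentwise_within)
      (auto simp: Basis_vec_def inner_axis intro!: has_derivative_inner_left)
  then show "\<exists>A. (dir_deriv v f has_derivative A) (at x) \<and> (\<forall>a w. A (a *s w) = a *s A w)"
    using A(2) by (intro exI[of _ "\<lambda>w. \<chi> j. A j w"]) (simp add: vec_eq_iff)
qed

lemma holomorphic_map_on_dir_deriv_commute: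
  fixes f :: "complex ^ 'n::finite \<Rightarrow> complex ^ 'm::finite"
  assumes S: "open S" and f: "holomorphic_map_on f S" and x: "x \<in> S"
  shows "dir_deriv w (dir_deriv v f) x = dir_deriv v (dir_deriv w f) x"
  using holomorphic_map_on_has_derivative[OF f] x
    holomorphic_map_on_has_derivative[OF holomorphic_map_on_dir_deriv[OF S f]]
  by (intro dir_deriv_commute[OF S]) (auto intro: differentiableI)

section \<open>Forms on a complex manifold\<close>

lemma alt_sum_Nil [simp]: "alt_sum A [] = 0"
  by (simp add: alt_sum_def)

lemma alt_sum_1 [simp]: "alt_sum A [v] = A v []"
  by (simp add: alt_sum_def)

lemma alt_sum_2 [simp]: "alt_sum A [v, w] = A v [w] - A w [v]"
  by (simp add: alt_sum_def numeral_2_eq_2)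

lemma alt_sum_3 [simp]: "alt_sum A [u, v, w] = A u [v, w] - A v [u, w] + A w [u, v]"
  by (simp add: alt_sum_def numeral_3_eq_3)

lemma alt_sum_add: "alt_sum (\<lambda>v ws. A v ws + B v ws) vs = alt_sum A vs + alt_sum B vs"
  by (simp add: alt_sum_def sum.distrib algebra_simps)

lemma alt_sum_diff: "alt_sum (\<lambda>v ws. A v ws - B v ws) vs = alt_sum A vs - alt_sum B vs"
  by (simp add: alt_sum_def sum_subtractf algebra_simps)

lemma alt_sum_eq_0:
  assumes "\<And>v ws. Suc (length ws) = length vs \<Longrightarrow> A v ws = 0"
  shows "alt_sum A vs = 0"
  unfolding alt_sum_def using assms by (intro sum.neutral) auto

lemma length_2_iff: "length vs = 2 \<longleftrightarrow> (\<exists>v w. vs = [v, w])"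
  by (auto simp: length_Suc_conv numeral_2_eq_2)

lemma length_3_iff: "length vs = 3 \<longleftrightarrow> (\<exists>u v w. vs = [u, v, w])"
  by (auto simp: length_Suc_conv numeral_3_eq_3)

lemma forms_eq_0_outside:
  "\<lbrakk>\<omega> \<in> forms \<A> k; c \<notin> \<A> \<or> x \<notin> chart_image c\<rbrakk> \<Longrightarrow> \<omega> c x vs = 0"
  unfolding forms_def by blast

lemma forms_alternating_multilinear:
  "\<lbrakk>\<omega> \<in> forms \<A> k; c \<in> \<A>; x \<in> chart_image c\<rbrakk> \<Longrightarrow> alternating_multilinear k (\<omega> c x)"
  unfolding forms_def by blast

lemma forms_eq_0_length: "\<lbrakk>\<omega> \<in> forms \<A> k; length vs \<noteq> k\<rbrakk> \<Longrightarrow> \<omega> c x vs = 0"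
  using forms_eq_0_outside forms_alternating_multilinear unfolding alternating_multilinear_def by metis

lemma forms_smooth: "\<lbrakk>\<omega> \<in> forms \<A> k; c \<in> \<A>\<rbrakk> \<Longrightarrow> smooth_on (\<lambda>x. \<omega> c x vs) (chart_image c)"
  unfolding forms_def by blast

lemma forms_transition:
  "\<lbrakk>\<omega> \<in> forms \<A> k; c \<in> \<A>; d \<in> \<A>; p \<in> fst c \<inter> fst d\<rbrakk> \<Longrightarrow>
    \<omega> c (snd c p) vs = \<omega> d (snd d p) (map (\<lambda>v. dir_deriv v (transition c d) (snd c p)) vs)"
  unfolding forms_def by blast

text \<open>The default value 0 at meaningless arguments is linear as well. Having linearity at
  every \<open>c\<close> and \<open>x\<close> matters for
  \<open>has_derivative_linear_family\<close>, which asks for it at all points.\<close>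

lemma forms_linear:
  assumes "\<omega> \<in> forms \<A> k" "length vs = k" "i < k"
  shows "linear (\<lambda>v. \<omega> c x (vs[i := v]))"
proof (cases "c \<in> \<A> \<and> x \<in> chart_image c")
  case True
  then show ?thesis
    using assms forms_alternating_multilinear[OF assms(1)] unfolding alternating_multilinear_def by blast
next
  case False
  then have "(\<lambda>v. \<omega> c x (vs[i := v])) = (\<lambda>v. 0)"
    using forms_eq_0_outside[OF assms(1)] by blast
  then show ?thesis by (simp add: linear_iff)
qed

lemma forms_1_linear: "\<omega> \<in> forms \<A> 1 \<Longrightarrow> linear (\<lambda>v. \<omega> c x [v])"
  \<comment> \<open>The entry \<open>undefined\<close> is a placeholder that the list update
    overwrites.\<close>
  using forms_linear[of \<omega> \<A> 1 "[undefined]" 0] by simp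

lemma forms_2_linear:
  assumes "\<omega> \<in> forms \<A> 2"
  shows "linear (\<lambda>v. \<omega> c x [v, w])" "linear (\<lambda>w. \<omega> c x [v, w])"
  using forms_linear[OF assms, of "[undefined, w]" 0] forms_linear[OF assms, of "[v, undefined]" 1] by auto

lemma forms_2_alternating: "\<omega> \<in> forms \<A> 2 \<Longrightarrow> \<omega> c x [v, v] = 0"
  using forms_alternating_multilinear[of \<omega> \<A> 2 c x] forms_eq_0_outside[of \<omega> \<A> 2 c x]
  unfolding alternating_multilinear_def
  by (metis One_nat_def Suc_1 length_Cons lessI list.size(3) nth_Cons_0 nth_Cons_Suc zero_less_one)

lemma forms_2_antisym:
  assumes "\<omega> \<in> forms \<A> 2"
  shows "\<omega> c x [w, v] = - \<omega> c x [v, w]"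
proof -
  have "\<omega> c x [v + w, v + w] = \<omega> c x [v, v] + \<omega> c x [v, w] + (\<omega> c x [w, v] + \<omega> c x [w, w])"
    by (simp add: linear_add[OF forms_2_linear(1)[OF assms]] linear_add[OF forms_2_linear(2)[OF assms]])
  then show ?thesis
    using forms_2_alternating[OF assms] by (simp add: eq_neg_iff_add_eq_0 add.commute)
qed

lemma forms_1I:
  fixes \<A> :: "('a, 'n::finite) chart set"
  assumes "\<And>c x vs. length vs \<noteq> 1 \<or> c \<notin> \<A> \<or> x \<notin> chart_image c \<Longrightarrow> \<omega> c x vs = 0"
    and "\<And>c x. c \<in> \<A> \<Longrightarrow> x \<in> chart_image c \<Longrightarrow> linear (\<lambda>v. \<omega> c x [v])"
    and "\<And>c v. c \<in> \<A> \<Longrightarrow> smooth_on (\<lambda>x. \<omega> c x [v]) (chart_image c)"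
    and "\<And>c d p v. \<lbrakk>c \<in> \<A>; d \<in> \<A>; p \<in> fst c; p \<in> fst d\<rbrakk> \<Longrightarrow>
      \<omega> c (snd c p) [v] = \<omega> d (snd d p) [dir_deriv v (transition c d) (snd c p)]"
  shows "\<omega> \<in> forms \<A> 1"
proof -
  have l: "length vs = 1 \<Longrightarrow> vs = [hd vs]" for vs :: "(complex ^ 'n) list"
    by (cases vs) auto
  have "smooth_on (\<lambda>x. \<omega> c x vs) (chart_image c)" if "c \<in> \<A>" for c vs
  proof (cases "length vs = 1")
    case True
    then show ?thesis using assms(3)[OF that] l by metis
  qed (simp add: assms(1) smooth_on_const)
  moreover have "\<omega> c (snd c p) vs = \<omega> d (snd d p) (map (\<lambda>v. dir_deriv v (transition c d) (snd c p)) vs)"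
    if "c \<in> \<A>" "d \<in> \<A>" "p \<in> fst c \<inter> fst d" for c d p vs
  proof (cases "length vs = 1")
    case True
    then show ?thesis using assms(4)[OF that(1,2)] that(3) by (auto simp: length_Suc_conv)
  qed (simp add: assms(1))
  moreover have "alternating_multilinear 1 (\<omega> c x)" if "c \<in> \<A>" "x \<in> chart_image c" for c x
    unfolding alternating_multilinear_def using assms(1) assms(2)[OF that]
    by (auto simp: length_Suc_conv)
  ultimately show ?thesis
    unfolding forms_def by (intro CollectI conjI allI ballI impI; blast intro: assms(1))
qed

lemma forms_2I:
  fixes \<A> :: "('a, 'n::finite) chart set"
  assumes "\<And>c x vs. length vs \<noteq> 2 \<or> c \<notin> \<A> \<or> x \<notin> chart_image c \<Longrightarrow> \<omega> c x vs = 0"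
    and "\<And>c x w. c \<in> \<A> \<Longrightarrow> x \<in> chart_image c \<Longrightarrow> linear (\<lambda>v. \<omega> c x [v, w])"
    and "\<And>c x v. c \<in> \<A> \<Longrightarrow> x \<in> chart_image c \<Longrightarrow> linear (\<lambda>w. \<omega> c x [v, w])"
    and "\<And>c x v. c \<in> \<A> \<Longrightarrow> x \<in> chart_image c \<Longrightarrow> \<omega> c x [v, v] = 0"
    and "\<And>c v w. c \<in> \<A> \<Longrightarrow> smooth_on (\<lambda>x. \<omega> c x [v, w]) (chart_image c)"
    and "\<And>c d p v w. \<lbrakk>c \<in> \<A>; d \<in> \<A>; p \<in> fst c; p \<in> fst d\<rbrakk> \<Longrightarrow> \<omega> c (snd c p) [v, w] =
      \<omega> d (snd d p) [dir_deriv v (transition c d) (snd c p), dir_deriv w (transition c d) (snd c p)]"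
  shows "\<omega> \<in> forms \<A> 2"
proof -
  have "smooth_on (\<lambda>x. \<omega> c x vs) (chart_image c)" if "c \<in> \<A>" for c vs
  proof (cases "length vs = 2")
    case True
    then show ?thesis using assms(5)[OF that] by (auto simp: length_2_iff)
  qed (simp add: assms(1) smooth_on_const)
  moreover have "\<omega> c (snd c p) vs = \<omega> d (snd d p) (map (\<lambda>v. dir_deriv v (transition c d) (snd c p)) vs)"
    if "c \<in> \<A>" "d \<in> \<A>" "p \<in> fst c \<inter> fst d" for c d p vs
  proof (cases "length vs = 2")
    case True
    then show ?thesis using assms(6)[OF that(1,2)] that(3) by (auto simp: length_2_iff)
  qed (simp add: assms(1))
  moreover have "alternating_multilinear 2 (\<omega> c x)" if "c \<in> \<A>" "x \<in> chart_image c" for c x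
    unfolding alternating_multilinear_def
  proof (intro conjI allI impI)
    fix vs :: "(complex ^ 'n) list" and i :: nat assume "length vs = 2 \<and> i < 2"
    then show "linear (\<lambda>v. \<omega> c x (vs[i := v]))"
      using assms(2,3)[OF that] by (auto simp: length_2_iff less_2_cases_iff)
  next
    fix vs :: "(complex ^ 'n) list" and i j :: nat assume "length vs = 2 \<and> i < j \<and> j < 2 \<and> vs ! i = vs ! j"
    then show "\<omega> c x vs = 0"
      using assms(4)[OF that] by (auto simp: length_2_iff less_2_cases_iff)
  qed (use assms(1) in auto)
  ultimately show ?thesis
    unfolding forms_def by (intro CollectI conjI allI ballI impI; blast intro: assms(1))
qed


section \<open>The connection and its parts\<close>

text \<open>The parameters \<open>(1, 0)\<close>, \<open>(1/2, -\<i>/2)\<close> and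
  \<open>(1/2, \<i>/2)\<close> give the identity and the projections to the (1,0)- and (0,1)-parts,
  so that \<open>conn\<close> covers d, del and delbar twisted by \<theta>.\<close>

definition lin_comb ::
  "complex \<Rightarrow> complex \<Rightarrow> (complex ^ 'n \<Rightarrow> complex) \<Rightarrow> complex ^ 'n \<Rightarrow> complex"
where
  "lin_comb a b \<xi> v = a * \<xi> v + b * \<xi> (\<i> *s v)"

definition conn ::
  "complex \<Rightarrow> complex \<Rightarrow> ('a, 'n::finite) form \<Rightarrow> ('a, 'n) form \<Rightarrow> ('a, 'n) form"
where
  "conn a b \<theta> \<omega> = diff_op (lin_comb a b) \<omega> - wedge1 (\<lambda>c x. lin_comb a b (\<lambda>v. \<theta> c x [v])) \<omega>"

lemma d_theta_eq_conn: "d_theta = conn 1 0"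
  by (simp add: fun_eq_iff d_theta_def conn_def ext_d_def lin_comb_def[abs_def])

lemma part10_eq_lin_comb: "part10 = lin_comb (1/2) (-\<i>/2)"
  by (simp add: fun_eq_iff part10_def lin_comb_def field_simps)

lemma del_theta_eq_conn: "del_theta = conn (1/2) (-\<i>/2)"
  by (intro ext) (simp add: del_theta_def conn_def part10_eq_lin_comb)

lemma part01_eq_lin_comb: "part01 = lin_comb (1/2) (\<i>/2)"
  by (simp add: fun_eq_iff part01_def lin_comb_def field_simps)

lemma delbar_theta_eq_conn: "delbar_theta = conn (1/2) (\<i>/2)"
  by (intro ext) (simp add: delbar_theta_def conn_def part01_eq_lin_comb)

definition cov :: "('a, 'n::finite) form \<Rightarrow> ('a, 'n) chart \<Rightarrow> complex ^ 'n \<Rightarrow>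
    (complex ^ 'n \<Rightarrow> complex) \<Rightarrow> complex ^ 'n \<Rightarrow> complex" where
  "cov \<theta> c v f x = dir_deriv v f x - \<theta> c x [v] * f x"

text \<open>This is the covariant derivative along the complexified vector a v + b J v, with J the
  multiplication by \<i> on tangent vectors; for the parameters of \<open>del_theta\<close> and
  \<open>delbar_theta\<close> it is the (1,0)- or (0,1)-part of \<open>v\<close>.\<close>

definition pcov :: "complex \<Rightarrow> complex \<Rightarrow> ('a, 'n::finite) form \<Rightarrow> ('a, 'n) chart \<Rightarrow> complex ^ 'n \<Rightarrow>
    (complex ^ 'n \<Rightarrow> complex) \<Rightarrow> complex ^ 'n \<Rightarrow> complex" where
  "pcov a b \<theta> c v f x = a * cov \<theta> c v f x + b * cov \<theta> c (\<i> *s v) f x"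

lemma cov_zero [simp]: "cov \<theta> c v (\<lambda>y. 0) x = 0"
  by (simp add: cov_def)

lemma pcov_zero [simp]: "pcov a b \<theta> c v (\<lambda>y. 0) x = 0"
  by (simp add: pcov_def)

text \<open>The differential and the wedge with \<theta> are alternating sums over the same
  positions, so they merge into one sum of covariant derivatives.\<close>

lemma conn_apply:
  assumes "\<omega> \<in> forms \<A> k"
  shows "conn a b \<theta> \<omega> c x vs =
    (if c \<in> \<A> \<and> x \<in> chart_image c then alt_sum (\<lambda>v ws. pcov a b \<theta> c v (\<lambda>y. \<omega> c y ws) x) vs else 0)"
proof (cases "c \<in> \<A> \<and> x \<in> chart_image c")
  case True
  then show ?thesis
    by (simp add: conn_def diff_op_def wedge1_def flip: alt_sum_diff)
      (simp add: pcov_def cov_def lin_comb_def algebra_simps)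
next
  case False
  \<comment> \<open>\<open>diff_op\<close> tests only whether \<open>x\<close> lies in the chart
    image; for \<open>c\<close> outside the atlas it differentiates the zero function.\<close>
  then have "\<omega> c x = (\<lambda>vs. 0)" "c \<notin> \<A> \<Longrightarrow> (\<lambda>y. \<omega> c y ws) = (\<lambda>y. 0)" for ws
    using forms_eq_0_outside[OF assms] by (auto simp: fun_eq_iff)
  with False show ?thesis
    by (auto simp: conn_def diff_op_def wedge1_def lin_comb_def alt_sum_eq_0)
qed

lemma conn_eq_0_length:
  assumes "\<omega> \<in> forms \<A> k" "length vs \<noteq> Suc k"
  shows "conn a b \<theta> \<omega> c x vs = 0"
proof -
  have "(\<lambda>y. \<omega> c y ws) = (\<lambda>y. 0)" if "Suc (length ws) = length vs" for ws
    using forms_eq_0_length[OF assms(1)] that assms(2) by auto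
  then show ?thesis by (simp add: conn_apply[OF assms(1)] alt_sum_eq_0)
qed

lemma d_theta_eq: "d_theta \<theta> \<omega> = del_theta \<theta> \<omega> + delbar_theta \<theta> \<omega>"
proof -
  have "lin_comb 1 0 \<xi> v = lin_comb (1/2) (-\<i>/2) \<xi> v + lin_comb (1/2) (\<i>/2) \<xi> v" for \<xi> and v :: "complex ^ 'b"
    by (simp add: lin_comb_def field_simps)
  then show ?thesis
    unfolding d_theta_eq_conn del_theta_eq_conn delbar_theta_eq_conn
    by (simp add: fun_eq_iff conn_def diff_op_def wedge1_def alt_sum_add distrib_right)
qed

text \<open>A product rule for evaluating a varying linear map at a varying vector.
  Differentiability of \<open>F\<close> is given only for each fixed vector; expanding in a basis
  reduces the claim to a finite sum of scalar multiples.\<close>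

lemma has_derivative_linear_family:
  fixes F :: "'f::real_normed_vector \<Rightarrow> 'b::euclidean_space \<Rightarrow> 'c::real_normed_vector"
  assumes lin: "\<And>y. linear (F y)"
    and F: "\<And>b. ((\<lambda>y. F y b) has_derivative F' b) (at (\<tau> x))"
    and \<tau>: "(\<tau> has_derivative \<tau>') (at x)"
    and u: "(u has_derivative u') (at x)"
  shows "((\<lambda>x. F (\<tau> x) (u x)) has_derivative (\<lambda>v. F (\<tau> x) (u' v) + F' (u x) (\<tau>' v))) (at x)"
proof -
  have expand: "F y b = (\<Sum>i\<in>Basis. (b \<bullet> i) *\<^sub>R F y i)" for y b
  proof -
    have "F y (\<Sum>i\<in>Basis. (b \<bullet> i) *\<^sub>R i) = (\<Sum>i\<in>Basis. (b \<bullet> i) *\<^sub>R F y i)"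
      by (simp add: linear_sum[OF lin] linear_cmul[OF lin])
    then show ?thesis by (simp add: euclidean_representation)
  qed
  have "((\<lambda>y. F y b) has_derivative (\<lambda>v. \<Sum>i\<in>Basis. (b \<bullet> i) *\<^sub>R F' i v)) (at (\<tau> x))" for b
    unfolding expand[of _ b] by (intro has_derivative_sum has_derivative_scaleR_right F)
  \<comment> \<open>Uniqueness of derivatives shows that \<open>F' b\<close> depends linearly on
    \<open>b\<close>, which allows the final sum to be folded back into
    \<open>F' (u x)\<close>.\<close>
  then have expand': "F' b = (\<lambda>v. \<Sum>i\<in>Basis. (b \<bullet> i) *\<^sub>R F' i v)" for b
    using F has_derivative_unique by blast
  have "((\<lambda>x. \<Sum>i\<in>Basis. (u x \<bullet> i) *\<^sub>R F (\<tau> x) i) has_derivative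
      (\<lambda>v. \<Sum>i\<in>Basis. (u x \<bullet> i) *\<^sub>R F' i (\<tau>' v) + (u' v \<bullet> i) *\<^sub>R F (\<tau> x) i)) (at x)"
    by (intro has_derivative_sum has_derivative_scaleR has_derivative_inner_left u
        has_derivative_compose[OF \<tau> F])
  then show ?thesis
    unfolding expand[symmetric] sum.distrib expand'[of "u x"] by (simp add: add.commute)
qed

section \<open>Charts, transition maps and the change of derivatives of forms between charts\<close>

locale complex_atlas =
  fixes X :: "'a topology" and \<A> :: "('a, 'n::finite) chart set"
  assumes complex_manifold: "complex_manifold X \<A>"
begin

abbreviation overlap :: "('a, 'n) chart \<Rightarrow> ('a, 'n) chart \<Rightarrow> (complex ^ 'n) set" where
  "overlap c d \<equiv> snd c ` (fst c \<inter> fst d)"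

lemma open_chart_image: "c \<in> \<A> \<Longrightarrow> open (chart_image c)"
  using complex_manifold unfolding complex_manifold_def by blast

lemma chart_homeomorphic_map:
  "c \<in> \<A> \<Longrightarrow> homeomorphic_map (subtopology X (fst c)) (top_of_set (chart_image c)) (snd c)"
  using complex_manifold unfolding complex_manifold_def by blast

lemma chart_openin: "c \<in> \<A> \<Longrightarrow> openin X (fst c)"
  using complex_manifold unfolding complex_manifold_def by blast

lemma chart_inj_on: "c \<in> \<A> \<Longrightarrow> inj_on (snd c) (fst c)"
  using homeomorphic_imp_injective_map[OF chart_homeomorphic_map] openin_subset[OF chart_openin]
  by (simp add: inf.absorb2)

lemma open_overlap:
  assumes "c \<in> \<A>" "d \<in> \<A>"
  shows "open (overlap c d)"
proof -
  have "openin (subtopology X (fst c)) (fst c \<inter> fst d)"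
    using chart_openin[OF assms(2)] by (rule openin_subtopology_Int2)
  then have "openin (top_of_set (chart_image c)) (overlap c d)"
    using homeomorphic_imp_open_map[OF chart_homeomorphic_map[OF assms(1)]] unfolding open_map_def by blast
  then show ?thesis using open_chart_image[OF assms(1)] openin_open_trans by blast
qed

lemma transition_apply:
  "\<lbrakk>c \<in> \<A>; p \<in> fst c\<rbrakk> \<Longrightarrow> transition c d (snd c p) = snd d p"
  by (simp add: transition_def inv_into_f_f[OF chart_inj_on])

lemma transition_holomorphic:
  "\<lbrakk>c \<in> \<A>; d \<in> \<A>\<rbrakk> \<Longrightarrow> holomorphic_map_on (transition c d) (overlap c d)"
  using complex_manifold unfolding complex_manifold_def by blast

lemma overlap_imp:
  "\<lbrakk>c \<in> \<A>; x \<in> overlap c d\<rbrakk> \<Longrightarrow> x \<in> chart_image c \<and> transition c d x \<in> chart_image d"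
  by (auto simp: chart_image_def transition_apply)

text \<open>With the coordinate \<open>x\<close> as variable in place of the point \<open>p\<close>,
  the pullback relation becomes an identity on an open set that can be differentiated.\<close>

lemma forms_overlap:
  assumes "\<omega> \<in> forms \<A> k" "c \<in> \<A>" "d \<in> \<A>" "x \<in> overlap c d"
  shows "\<omega> c x vs = \<omega> d (transition c d x) (map (\<lambda>v. dir_deriv v (transition c d) x) vs)"
proof -
  obtain p where p: "p \<in> fst c \<inter> fst d" "x = snd c p" using assms(4) by auto
  then show ?thesis using forms_transition[OF assms(1-3) p(1)] transition_apply[OF assms(2), of p d] by simp
qed

lemma transition_has_derivative:
  "\<lbrakk>c \<in> \<A>; d \<in> \<A>; x \<in> overlap c d\<rbrakk> \<Longrightarrow>
    (transition c d has_derivative (\<lambda>v. dir_deriv v (transition c d) x)) (at x)"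
  by (rule holomorphic_map_on_has_derivative[OF transition_holomorphic])

lemma forms_has_derivative:
  "\<lbrakk>\<omega> \<in> forms \<A> k; c \<in> \<A>; x \<in> chart_image c\<rbrakk> \<Longrightarrow>
    ((\<lambda>y. \<omega> c y vs) has_derivative (\<lambda>v. dir_deriv v (\<lambda>y. \<omega> c y vs) x)) (at x)"
  by (rule smooth_on_has_derivative[OF forms_smooth])

lemma dir_deriv_form_0_overlap:
  assumes "\<omega> \<in> forms \<A> 0" "c \<in> \<A>" "d \<in> \<A>" "x \<in> overlap c d"
  shows "dir_deriv v (\<lambda>y. \<omega> c y []) x =
    dir_deriv (dir_deriv v (transition c d) x) (\<lambda>y. \<omega> d y []) (transition c d x)"
proof -
  have "((\<lambda>y. \<omega> d (transition c d y) []) has_derivative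
    (\<lambda>v. dir_deriv (dir_deriv v (transition c d) x) (\<lambda>y. \<omega> d y []) (transition c d x))) (at x)"
    using overlap_imp assms
    by (intro has_derivative_compose[OF transition_has_derivative forms_has_derivative]) auto
  then have "((\<lambda>y. \<omega> c y []) has_derivative
    (\<lambda>v. dir_deriv (dir_deriv v (transition c d) x) (\<lambda>y. \<omega> d y []) (transition c d x))) (at x)"
    by (rule has_derivative_transform_within_open[OF _ open_overlap[OF assms(2,3)] assms(4)])
      (simp only: forms_overlap[OF assms(1-3), where vs = "[]"] list.map)
  then show ?thesis by (rule dir_deriv_eqI)
qed

text \<open>The argument \<open>dir_deriv w (transition c d)\<close> of the form varies with the
  point too; its derivative produces the first term on the right.\<close>

lemma dir_deriv_form_1_overlap:
  assumes "\<omega> \<in> forms \<A> 1" "c \<in> \<A>" "d \<in> \<A>" "x \<in> overlap c d"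
  shows "dir_deriv v (\<lambda>y. \<omega> c y [w]) x =
    \<omega> d (transition c d x) [dir_deriv v (dir_deriv w (transition c d)) x] +
    dir_deriv (dir_deriv v (transition c d) x)
      (\<lambda>y. \<omega> d y [dir_deriv w (transition c d) x]) (transition c d x)"
proof -
  let ?\<tau> = "transition c d"
  have "(dir_deriv w ?\<tau> has_derivative (\<lambda>v. dir_deriv v (dir_deriv w ?\<tau>) x)) (at x)"
    by (rule holomorphic_map_on_has_derivative[OF holomorphic_map_on_dir_deriv[OF
          open_overlap[OF assms(2,3)] transition_holomorphic[OF assms(2,3)]] assms(4)])
  then have "((\<lambda>y. \<omega> d (?\<tau> y) [dir_deriv w ?\<tau> y]) has_derivative
    (\<lambda>v. \<omega> d (?\<tau> x) [dir_deriv v (dir_deriv w ?\<tau>) x] +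
      dir_deriv (dir_deriv v ?\<tau> x) (\<lambda>y. \<omega> d y [dir_deriv w ?\<tau> x]) (?\<tau> x))) (at x)"
    using overlap_imp assms
    by (intro has_derivative_linear_family[where F = "\<lambda>y u. \<omega> d y [u]"] forms_1_linear
        transition_has_derivative forms_has_derivative) auto
  then have "((\<lambda>y. \<omega> c y [w]) has_derivative
    (\<lambda>v. \<omega> d (?\<tau> x) [dir_deriv v (dir_deriv w ?\<tau>) x] +
      dir_deriv (dir_deriv v ?\<tau> x) (\<lambda>y. \<omega> d y [dir_deriv w ?\<tau> x]) (?\<tau> x))) (at x)"
    by (rule has_derivative_transform_within_open[OF _ open_overlap[OF assms(2,3)] assms(4)])
      (simp only: forms_overlap[OF assms(1-3), where vs = "[w]"] list.map)
  then show ?thesis by (rule dir_deriv_eqI)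
qed

lemma transition_dir_deriv_2_smult:
  assumes "c \<in> \<A>" "d \<in> \<A>" "x \<in> overlap c d"
  shows "dir_deriv (a *s v) (dir_deriv w (transition c d)) x = a *s dir_deriv v (dir_deriv w (transition c d)) x"
  by (rule holomorphic_map_on_dir_deriv_smult[OF holomorphic_map_on_dir_deriv[OF
        open_overlap[OF assms(1,2)] transition_holomorphic[OF assms(1,2)]] assms(3)])

lemma transition_dir_deriv_2_commute:
  assumes "c \<in> \<A>" "d \<in> \<A>" "x \<in> overlap c d"
  shows "dir_deriv v (dir_deriv w (transition c d)) x = dir_deriv w (dir_deriv v (transition c d)) x"
  by (rule holomorphic_map_on_dir_deriv_commute[OF
        open_overlap[OF assms(1,2)] transition_holomorphic[OF assms(1,2)] assms(3)])

lemma forms_zero: "0 \<in> forms \<A> k"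
  by (auto simp: forms_def alternating_multilinear_def smooth_on_const linear_iff)

lemma forms_add:
  assumes "\<omega> \<in> forms \<A> k" "\<eta> \<in> forms \<A> k"
  shows "\<omega> + \<eta> \<in> forms \<A> k"
proof -
  have "alternating_multilinear k ((\<omega> + \<eta>) c x)" if "c \<in> \<A>" "x \<in> chart_image c" for c x
    using forms_alternating_multilinear[OF assms(1) that] forms_alternating_multilinear[OF assms(2) that]
    unfolding alternating_multilinear_def by (simp add: linear_compose_add)
  moreover have "smooth_on (\<lambda>x. (\<omega> + \<eta>) c x vs) (chart_image c)" if "c \<in> \<A>" for c vs
    using smooth_on_add[OF open_chart_image[OF that] forms_smooth[OF assms(1) that] forms_smooth[OF assms(2) that]]
    by simp
  moreover have "(\<omega> + \<eta>) c (snd c p) vs =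
      (\<omega> + \<eta>) d (snd d p) (map (\<lambda>v. dir_deriv v (transition c d) (snd c p)) vs)"
    if "c \<in> \<A>" "d \<in> \<A>" "p \<in> fst c \<inter> fst d" for c d p vs
    using forms_transition[OF assms(1) that, of vs] forms_transition[OF assms(2) that, of vs] by simp
  moreover have "(\<omega> + \<eta>) c x vs = 0" if "c \<notin> \<A> \<or> x \<notin> chart_image c" for c x vs
    using forms_eq_0_outside[OF assms(1) that, of vs] forms_eq_0_outside[OF assms(2) that, of vs] by simp
  ultimately show ?thesis
    unfolding forms_def by (intro CollectI conjI allI ballI impI; blast)
qed

lemma forms_uminus:
  assumes "\<omega> \<in> forms \<A> k"
  shows "- \<omega> \<in> forms \<A> k"
proof -
  have "alternating_multilinear k ((- \<omega>) c x)" if "c \<in> \<A>" "x \<in> chart_image c" for c x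
    using forms_alternating_multilinear[OF assms that]
    unfolding alternating_multilinear_def by (simp add: linear_compose_neg)
  moreover have "smooth_on (\<lambda>x. (- \<omega>) c x vs) (chart_image c)" if "c \<in> \<A>" for c vs
    using smooth_on_uminus[OF open_chart_image[OF that] forms_smooth[OF assms that]] by simp
  moreover have "(- \<omega>) c (snd c p) vs =
      (- \<omega>) d (snd d p) (map (\<lambda>v. dir_deriv v (transition c d) (snd c p)) vs)"
    if "c \<in> \<A>" "d \<in> \<A>" "p \<in> fst c \<inter> fst d" for c d p vs
    using forms_transition[OF assms that, of vs] by simp
  moreover have "(- \<omega>) c x vs = 0" if "c \<notin> \<A> \<or> x \<notin> chart_image c" for c x vs
    using forms_eq_0_outside[OF assms that, of vs] by simp
  ultimately show ?thesis
    unfolding forms_def by (intro CollectI conjI allI ballI impI; blast)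
qed

end

section \<open>Covariant derivatives for a closed form \<theta>\<close>

locale flat_line_bundle = complex_atlas X \<A>
  for X :: "'a topology" and \<A> :: "('a, 'n::finite) chart set" +
  fixes \<theta> :: "('a, 'n) form"
  assumes theta_form: "\<theta> \<in> forms \<A> 1"
    and theta_closed: "ext_d \<theta> = 0"
begin

lemma dir_deriv_theta_sym:
  assumes "x \<in> chart_image c"
  shows "dir_deriv u (\<lambda>y. \<theta> c y [v]) x = dir_deriv v (\<lambda>y. \<theta> c y [u]) x"
proof -
  have "ext_d \<theta> c x [u, v] = 0" by (simp add: theta_closed)
  then show ?thesis using assms by (simp add: ext_d_def diff_op_def)
qed

lemma cov_cong:
  assumes "c \<in> \<A>" "x \<in> chart_image c" "\<And>y. y \<in> chart_image c \<Longrightarrow> f y = g y"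
  shows "cov \<theta> c v f x = cov \<theta> c v g x"
  using frechet_derivative_cong_open[OF open_chart_image[OF assms(1)] assms(2,3)] assms(2,3)
  by (simp add: cov_def)

lemma smooth_cov:
  assumes "c \<in> \<A>" "smooth_on f (chart_image c)"
  shows "smooth_on (cov \<theta> c v f) (chart_image c)"
  unfolding cov_def[abs_def]
  by (intro smooth_on_diff smooth_on_mult smooth_on_dir_deriv forms_smooth[OF theta_form]
      open_chart_image assms)

lemma cov_linear:
  assumes "x \<in> chart_image c" "smooth_on f (chart_image c)"
  shows "linear (\<lambda>v. cov \<theta> c v f x)"
proof -
  have "linear (\<lambda>v. dir_deriv v f x)"
    using smooth_on_has_derivative[OF assms(2,1)] by (rule has_derivative_linear)
  then show ?thesis
    using forms_1_linear[OF theta_form, of c x]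
    by (simp add: linear_iff cov_def algebra_simps)
qed

lemma cov_add:
  assumes "x \<in> chart_image c" "smooth_on f (chart_image c)" "smooth_on g (chart_image c)"
  shows "cov \<theta> c v (\<lambda>y. f y + g y) x = cov \<theta> c v f x + cov \<theta> c v g x"
  using assms by (simp add: cov_def dir_deriv_add smooth_on_imp_differentiable algebra_simps)

lemma cov_cmult:
  assumes "x \<in> chart_image c" "smooth_on f (chart_image c)"
  shows "cov \<theta> c v (\<lambda>y. k * f y) x = k * cov \<theta> c v f x"
  using assms by (simp add: cov_def dir_deriv_cmult smooth_on_imp_differentiable algebra_simps)

text \<open>The connection is flat because \<open>\<theta>\<close> is closed.\<close>

lemma cov_commute:
  assumes c: "c \<in> \<A>" and x: "x \<in> chart_image c" and f: "smooth_on f (chart_image c)"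
  shows "cov \<theta> c u (cov \<theta> c v f) x = cov \<theta> c v (cov \<theta> c u f) x"
proof -
  note o = open_chart_image[OF c] and th = forms_smooth[OF theta_form c]
  \<comment> \<open>The last two lines of the expansion are symmetric in \<open>u\<close> and
    \<open>v\<close> as they stand; the first is symmetric by equality of mixed derivatives and by
    closedness of \<theta>.\<close>
  have *: "cov \<theta> c u (cov \<theta> c v f) x =
      dir_deriv u (dir_deriv v f) x - dir_deriv u (\<lambda>y. \<theta> c y [v]) x * f x
      - (\<theta> c x [v] * dir_deriv u f x + \<theta> c x [u] * dir_deriv v f x)
      + \<theta> c x [u] * (\<theta> c x [v] * f x)" for u v
  proof -
    have "((\<lambda>y. dir_deriv v f y - \<theta> c y [v] * f y) has_derivative
      (\<lambda>u. dir_deriv u (dir_deriv v f) x -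
        (\<theta> c x [v] * dir_deriv u f x + dir_deriv u (\<lambda>y. \<theta> c y [v]) x * f x))) (at x)"
      by (intro has_derivative_diff has_derivative_mult smooth_on_has_derivative[OF _ x]
          smooth_on_dir_deriv f th)
    from dir_deriv_eqI[OF this] show ?thesis
      by (simp add: cov_def[abs_def] algebra_simps)
  qed
  show ?thesis
    unfolding * smooth_on_dir_deriv_commute[OF o f x, of u v] dir_deriv_theta_sym[OF x, of u v]
    by (simp add: algebra_simps)
qed

abbreviation P :: "complex \<Rightarrow> complex \<Rightarrow> ('a, 'n) chart \<Rightarrow> complex ^ 'n \<Rightarrow>
    (complex ^ 'n \<Rightarrow> complex) \<Rightarrow> complex ^ 'n \<Rightarrow> complex" where
  "P a b \<equiv> pcov a b \<theta>"

lemma pcov_cong: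
  assumes "c \<in> \<A>" "x \<in> chart_image c" "\<And>y. y \<in> chart_image c \<Longrightarrow> f y = g y"
  shows "P a b c v f x = P a b c v g x"
  unfolding pcov_def using cov_cong[OF assms] by presburger

lemma smooth_pcov:
  assumes "c \<in> \<A>" "smooth_on f (chart_image c)"
  shows "smooth_on (P a b c v f) (chart_image c)"
  unfolding pcov_def[abs_def]
  by (intro smooth_on_add smooth_on_mult smooth_on_const smooth_cov open_chart_image assms)

lemma pcov_linear:
  assumes "x \<in> chart_image c" "smooth_on f (chart_image c)"
  shows "linear (\<lambda>v. P a b c v f x)"
  using cov_linear[OF assms]
  by (simp add: linear_iff pcov_def smult.add_right smult.scaleR_right algebra_simps)

lemma pcov_add:
  assumes "x \<in> chart_image c" "smooth_on f (chart_image c)" "smooth_on g (chart_image c)"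
  shows "P a b c v (\<lambda>y. f y + g y) x = P a b c v f x + P a b c v g x"
  by (simp add: pcov_def cov_add[OF assms] algebra_simps)

lemma pcov_cmult:
  assumes "x \<in> chart_image c" "smooth_on f (chart_image c)"
  shows "P a b c v (\<lambda>y. k * f y) x = k * P a b c v f x"
  by (simp add: pcov_def cov_cmult[OF assms] algebra_simps)

lemma pcov_diff:
  assumes "c \<in> \<A>" "x \<in> chart_image c" "smooth_on f (chart_image c)" "smooth_on g (chart_image c)"
  shows "P a b c v (\<lambda>y. f y - g y) x = P a b c v f x - P a b c v g x"
proof -
  have "smooth_on (\<lambda>y. - 1 * g y) (chart_image c)"
    using smooth_on_uminus[OF open_chart_image[OF assms(1)] assms(4)] by simp
  then show ?thesis
    using pcov_add[OF assms(2,3), of "\<lambda>y. - 1 * g y" a b v] pcov_cmult[OF assms(2,4), of a b v "- 1"]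
    by simp
qed

text \<open>Both sides are combinations of the same four iterated covariant derivatives, each of
  which commutes. Every pair of parameters stays attached to its own direction.\<close>

lemma pcov_commute:
  assumes c: "c \<in> \<A>" and x: "x \<in> chart_image c" and f: "smooth_on f (chart_image c)"
  shows "P a b c u (P a' b' c v f) x = P a' b' c v (P a b c u f) x"
proof -
  have expand: "P a b c u (P a' b' c v f) x =
    a * (a' * cov \<theta> c u (cov \<theta> c v f) x + b' * cov \<theta> c u (cov \<theta> c (\<i> *s v) f) x) +
    b * (a' * cov \<theta> c (\<i> *s u) (cov \<theta> c v f) x + b' * cov \<theta> c (\<i> *s u) (cov \<theta> c (\<i> *s v) f) x)"
    for a b a' b' u v
  proof -
    have s: "smooth_on (\<lambda>y. k * cov \<theta> c w f y) (chart_image c)" for k w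
      by (intro smooth_on_mult smooth_on_const smooth_cov open_chart_image c f)
    show ?thesis
      unfolding pcov_def[abs_def]
      by (simp add: cov_add[OF x s s] cov_cmult[OF x smooth_cov[OF c f]])
  qed
  show ?thesis
    unfolding expand using cov_commute[OF c x f] by (simp add: algebra_simps)
qed

lemma conn_0_apply:
  assumes "f \<in> forms \<A> 0" "c \<in> \<A>" "x \<in> chart_image c"
  shows "conn a b \<theta> f c x [v] = P a b c v (\<lambda>y. f c y []) x"
  using assms by (simp add: conn_apply[OF assms(1)])

lemma conn_1_apply:
  assumes "\<omega> \<in> forms \<A> 1" "c \<in> \<A>" "x \<in> chart_image c"
  shows "conn a b \<theta> \<omega> c x [v, w] = P a b c v (\<lambda>y. \<omega> c y [w]) x - P a b c w (\<lambda>y. \<omega> c y [v]) x"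
  using assms by (simp add: conn_apply[OF assms(1)])

lemma conn_2_apply:
  assumes "\<omega> \<in> forms \<A> 2" "c \<in> \<A>" "x \<in> chart_image c"
  shows "conn a b \<theta> \<omega> c x [u, v, w] = P a b c u (\<lambda>y. \<omega> c y [v, w]) x -
    P a b c v (\<lambda>y. \<omega> c y [u, w]) x + P a b c w (\<lambda>y. \<omega> c y [u, v]) x"
  using assms by (simp add: conn_apply[OF assms(1)])

lemma conn_add:
  assumes "\<omega> \<in> forms \<A> k" "\<eta> \<in> forms \<A> k"
  shows "conn a b \<theta> (\<omega> + \<eta>) = conn a b \<theta> \<omega> + conn a b \<theta> \<eta>"
proof (intro ext)
  fix c x vs
  have "P a b c v (\<lambda>y. \<omega> c y ws + \<eta> c y ws) x = P a b c v (\<lambda>y. \<omega> c y ws) x + P a b c v (\<lambda>y. \<eta> c y ws) x"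
    if "c \<in> \<A>" "x \<in> chart_image c" for v ws
    using that assms by (intro pcov_add forms_smooth) auto
  then show "conn a b \<theta> (\<omega> + \<eta>) c x vs = (conn a b \<theta> \<omega> + conn a b \<theta> \<eta>) c x vs"
    by (simp add: conn_apply[OF assms(1)] conn_apply[OF assms(2)] conn_apply[OF forms_add[OF assms]]
        flip: alt_sum_add)
qed

section \<open>Compatibility of the operators with changes of chart\<close>

lemma theta_overlap:
  assumes "c \<in> \<A>" "d \<in> \<A>" "x \<in> overlap c d"
  shows "\<theta> c x [v] = \<theta> d (transition c d x) [dir_deriv v (transition c d) x]"
  using forms_overlap[OF theta_form assms, of "[v]"] by simp

lemma transition_dir_deriv_smult:
  assumes "c \<in> \<A>" "d \<in> \<A>" "x \<in> overlap c d"
  shows "dir_deriv (a *s v) (transition c d) x = a *s dir_deriv v (transition c d) x"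
  by (rule holomorphic_map_on_dir_deriv_smult[OF transition_holomorphic[OF assms(1,2)] assms(3)])

text \<open>The derivative of a transition map is complex linear, hence carries
  \<open>\<i> *s v\<close> to \<i> times the image of \<open>v\<close>; this is what makes the
  (1,0)- and (0,1)-parts independent of the chart.\<close>

lemma pcov_form_0_overlap:
  assumes "f \<in> forms \<A> 0" "c \<in> \<A>" "d \<in> \<A>" "x \<in> overlap c d"
  shows "P a b c v (\<lambda>y. f c y []) x =
    P a b d (dir_deriv v (transition c d) x) (\<lambda>y. f d y []) (transition c d x)"
  unfolding pcov_def cov_def dir_deriv_form_0_overlap[OF assms]
    theta_overlap[OF assms(2-4)] transition_dir_deriv_smult[OF assms(2-4)]
  using forms_overlap[OF assms, of "[]"] by simp

lemma pcov_form_1_overlap: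
  assumes "\<omega> \<in> forms \<A> 1" "c \<in> \<A>" "d \<in> \<A>" "x \<in> overlap c d"
  shows "P a b c v (\<lambda>y. \<omega> c y [w]) x =
    P a b d (dir_deriv v (transition c d) x) (\<lambda>y. \<omega> d y [dir_deriv w (transition c d) x]) (transition c d x)
    + a * \<omega> d (transition c d x) [dir_deriv v (dir_deriv w (transition c d)) x]
    + b * \<omega> d (transition c d x) [\<i> *s dir_deriv v (dir_deriv w (transition c d)) x]"
  unfolding pcov_def cov_def dir_deriv_form_1_overlap[OF assms]
    theta_overlap[OF assms(2-4)] transition_dir_deriv_smult[OF assms(2-4)]
    transition_dir_deriv_2_smult[OF assms(2-4)]
  using forms_overlap[OF assms, of "[w]"] by (simp add: algebra_simps)

lemma conn_form_1:
  assumes f: "f \<in> forms \<A> 0"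
  shows "conn a b \<theta> f \<in> forms \<A> 1"
proof (rule forms_1I)
  show "conn a b \<theta> f c x vs = 0" if "length vs \<noteq> 1 \<or> c \<notin> \<A> \<or> x \<notin> chart_image c" for c x vs
    using that conn_eq_0_length[OF f] by (cases "length vs = 1") (auto simp: conn_apply[OF f])
  show "linear (\<lambda>v. conn a b \<theta> f c x [v])" if "c \<in> \<A>" "x \<in> chart_image c" for c x
    unfolding conn_0_apply[OF f that] by (intro pcov_linear forms_smooth[OF f] that)
  show "smooth_on (\<lambda>x. conn a b \<theta> f c x [v]) (chart_image c)" if "c \<in> \<A>" for c v
    by (rule smooth_on_cong[OF open_chart_image[OF that] _ smooth_pcov[OF that forms_smooth[OF f that]]])
      (simp add: conn_0_apply[OF f that])
  show "conn a b \<theta> f c (snd c p) [v] = conn a b \<theta> f d (snd d p) [dir_deriv v (transition c d) (snd c p)]"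
    if c: "c \<in> \<A>" and d: "d \<in> \<A>" and p: "p \<in> fst c" "p \<in> fst d" for c d p v
  proof -
    have x: "snd c p \<in> overlap c d" "snd c p \<in> chart_image c" "snd d p \<in> chart_image d"
      using p by (auto simp: chart_image_def)
    show ?thesis
      unfolding conn_0_apply[OF f c x(2)] conn_0_apply[OF f d x(3)] pcov_form_0_overlap[OF f c d x(1)]
        transition_apply[OF c p(1)] ..
  qed
qed

lemma pcov_form_1_linear:
  assumes "\<omega> \<in> forms \<A> 1" "c \<in> \<A>" "x \<in> chart_image c"
  shows "linear (\<lambda>w. P a b c v (\<lambda>y. \<omega> c y [w]) x)"
proof (rule linearI)
  note lin = forms_1_linear[OF assms(1)] and s = forms_smooth[OF assms(1,2)]
  fix w w' and r :: real
  show "P a b c v (\<lambda>y. \<omega> c y [w + w']) x = P a b c v (\<lambda>y. \<omega> c y [w]) x + P a b c v (\<lambda>y. \<omega> c y [w']) x"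
    unfolding linear_add[OF lin] by (rule pcov_add[OF assms(3) s s])
  show "P a b c v (\<lambda>y. \<omega> c y [r *\<^sub>R w]) x = r *\<^sub>R P a b c v (\<lambda>y. \<omega> c y [w]) x"
    unfolding linear_cmul[OF lin] scaleR_conv_of_real[where 'a = complex] by (rule pcov_cmult[OF assms(3) s])
qed

text \<open>The second derivatives of the transition maps, which enter through \<open>pcov_form_1_overlap\<close>,
  are symmetric and complex bilinear, so they cancel in the antisymmetrization.\<close>

lemma conn_form_2:
  assumes f: "\<omega> \<in> forms \<A> 1"
  shows "conn a b \<theta> \<omega> \<in> forms \<A> 2"
proof (rule forms_2I)
  show "conn a b \<theta> \<omega> c x vs = 0" if "length vs \<noteq> 2 \<or> c \<notin> \<A> \<or> x \<notin> chart_image c" for c x vs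
    using that conn_eq_0_length[OF f, of vs] by (cases "length vs = 2") (auto simp: conn_apply[OF f])
  show "linear (\<lambda>v. conn a b \<theta> \<omega> c x [v, w])" if "c \<in> \<A>" "x \<in> chart_image c" for c x w
    unfolding conn_1_apply[OF f that]
    by (intro linear_compose_sub pcov_linear pcov_form_1_linear forms_smooth[OF f] f that)
  show "linear (\<lambda>w. conn a b \<theta> \<omega> c x [v, w])" if "c \<in> \<A>" "x \<in> chart_image c" for c x v
    unfolding conn_1_apply[OF f that]
    by (intro linear_compose_sub pcov_linear pcov_form_1_linear forms_smooth[OF f] f that)
  show "conn a b \<theta> \<omega> c x [v, v] = 0" if "c \<in> \<A>" "x \<in> chart_image c" for c x v
    unfolding conn_1_apply[OF f that] by simp
  show "smooth_on (\<lambda>x. conn a b \<theta> \<omega> c x [v, w]) (chart_image c)" if "c \<in> \<A>" for c v w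
    by (rule smooth_on_cong[OF open_chart_image[OF that] _ smooth_on_diff[OF open_chart_image[OF that]
            smooth_pcov[OF that forms_smooth[OF f that]] smooth_pcov[OF that forms_smooth[OF f that]]]])
      (simp add: conn_1_apply[OF f that])
  show "conn a b \<theta> \<omega> c (snd c p) [v, w] = conn a b \<theta> \<omega> d (snd d p)
      [dir_deriv v (transition c d) (snd c p), dir_deriv w (transition c d) (snd c p)]"
    if c: "c \<in> \<A>" and d: "d \<in> \<A>" and p: "p \<in> fst c" "p \<in> fst d" for c d p v w
  proof -
    have x: "snd c p \<in> overlap c d" "snd c p \<in> chart_image c" "snd d p \<in> chart_image d"
      using p by (auto simp: chart_image_def)
    show ?thesis
      unfolding conn_1_apply[OF f c x(2)] conn_1_apply[OF f d x(3)] pcov_form_1_overlap[OF f c d x(1)]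
        transition_apply[OF c p(1)] transition_dir_deriv_2_commute[OF c d x(1), of w v]
      by simp
  qed
qed

text \<open>On \<open>[v, w]\<close> each composition is an antisymmetrized second covariant
  derivative; by \<open>pcov_commute\<close> the terms of one composition are the negatives of those
  of the other. Elsewhere all values are 0 by default.\<close>

lemma conn_anticommute_0:
  assumes f: "f \<in> forms \<A> 0"
  shows "conn a b \<theta> (conn a' b' \<theta> f) + conn a' b' \<theta> (conn a b \<theta> f) = 0"
proof (intro ext)
  fix c x vs
  note f1 = conn_form_1[OF f]
  show "(conn a b \<theta> (conn a' b' \<theta> f) + conn a' b' \<theta> (conn a b \<theta> f)) c x vs = 0 c x vs"
  proof (cases "c \<in> \<A> \<and> x \<in> chart_image c \<and> length vs = 2")
    case True
    then obtain v w where c: "c \<in> \<A>" and x: "x \<in> chart_image c" and vs: "vs = [v, w]"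
      by (auto simp: length_2_iff)
    note s = forms_smooth[OF f c, of "[]"]
    have *: "conn a b \<theta> (conn a' b' \<theta> f) c x [v, w] =
        P a b c v (P a' b' c w (\<lambda>y. f c y [])) x - P a b c w (P a' b' c v (\<lambda>y. f c y [])) x"
      for a b a' b'
    proof -
      have "P a b c v (\<lambda>y. conn a' b' \<theta> f c y [w]) x = P a b c v (P a' b' c w (\<lambda>y. f c y [])) x" for v w
        by (rule pcov_cong[OF c x conn_0_apply[OF f c]])
      then show ?thesis by (simp add: conn_1_apply[OF f1 c x])
    qed
    show ?thesis
      unfolding vs plus_fun_apply *
      by (simp add: pcov_commute[OF c x s, of a b v a' b' w] pcov_commute[OF c x s, of a b w a' b' v])
  next
    case outside: False
    show ?thesis
    proof (cases "length vs = 2")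
      case True
      with outside show ?thesis by (auto simp: conn_apply[OF f1])
    next
      case False
      then show ?thesis using conn_eq_0_length[OF f1, of vs] by simp
    qed
  qed
qed

lemma conn_anticommute_1:
  assumes f: "\<omega> \<in> forms \<A> 1"
  shows "conn a b \<theta> (conn a' b' \<theta> \<omega>) + conn a' b' \<theta> (conn a b \<theta> \<omega>) = 0"
proof (intro ext)
  fix c x vs
  note f1 = conn_form_2[OF f]
  show "(conn a b \<theta> (conn a' b' \<theta> \<omega>) + conn a' b' \<theta> (conn a b \<theta> \<omega>)) c x vs = 0 c x vs"
  proof (cases "c \<in> \<A> \<and> x \<in> chart_image c \<and> length vs = 3")
    case True
    then obtain u v w where c: "c \<in> \<A>" and x: "x \<in> chart_image c" and vs: "vs = [u, v, w]"
      by (auto simp: length_3_iff)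
    note s = forms_smooth[OF f c]
    \<comment> \<open>Each composition is the sum of \<open>Q\<close> over the six orders of
      \<open>u\<close>, \<open>v\<close>, \<open>w\<close>, weighted with the signs of the
      permutations.\<close>
    define Q where "Q a b a' b' u v w = P a b c u (P a' b' c v (\<lambda>y. \<omega> c y [w])) x" for a b a' b' u v w
    have *: "conn a b \<theta> (conn a' b' \<theta> \<omega>) c x [u, v, w] =
        (Q a b a' b' u v w - Q a b a' b' u w v) - (Q a b a' b' v u w - Q a b a' b' v w u)
        + (Q a b a' b' w u v - Q a b a' b' w v u)"
      for a b a' b'
    proof -
      have "P a b c u (\<lambda>y. conn a' b' \<theta> \<omega> c y [v, w]) x = Q a b a' b' u v w - Q a b a' b' u w v" for u v w
      proof -
        have "P a b c u (\<lambda>y. conn a' b' \<theta> \<omega> c y [v, w]) x =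
          P a b c u (\<lambda>y. P a' b' c v (\<lambda>y. \<omega> c y [w]) y - P a' b' c w (\<lambda>y. \<omega> c y [v]) y) x"
          by (rule pcov_cong[OF c x conn_1_apply[OF f c]])
        also have "\<dots> = Q a b a' b' u v w - Q a b a' b' u w v"
          unfolding Q_def by (rule pcov_diff[OF c x smooth_pcov[OF c s] smooth_pcov[OF c s]])
        finally show ?thesis .
      qed
      then show ?thesis by (simp add: conn_2_apply[OF f1 c x])
    qed
    \<comment> \<open>Exchanging the operators transposes two arguments and so flips the sign of the
      permutation: the twelve terms cancel in pairs.\<close>
    have "Q a b a' b' u v w = Q a' b' a b v u w" for u v w
      unfolding Q_def by (rule pcov_commute[OF c x s])
    then show ?thesis
      unfolding vs plus_fun_apply * by simp
  next
    case outside: False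
    show ?thesis
    proof (cases "length vs = 3")
      case True
      with outside show ?thesis by (auto simp: conn_apply[OF f1])
    next
      case False
      then show ?thesis using conn_eq_0_length[OF f1, of vs] by simp
    qed
  qed
qed

end

section \<open>Types of forms\<close>

lemma wedge_list_eq_0_length: "length vs \<noteq> length \<xi>s \<Longrightarrow> wedge_list \<xi>s vs = 0"
proof (induction \<xi>s arbitrary: vs)
  case (Cons \<xi> \<xi>s)
  then have "wedge_list \<xi>s ws = 0" if "Suc (length ws) = length vs" for ws
    using that by auto
  then show ?case by (simp add: alt_sum_eq_0)
qed auto

lemma dz_dzbar_1_0: "dz_dzbar [i] [] [v] = v $ i"
  by (simp add: dz_dzbar_def)

lemma dz_dzbar_0_1: "dz_dzbar [] [j] [v] = cnj (v $ j)"
  by (simp add: dz_dzbar_def)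

lemma dz_dzbar_1_1: "dz_dzbar [i] [j] [v, w] = v $ i * cnj (w $ j) - w $ i * cnj (v $ j)"
  by (simp add: dz_dzbar_def)

text \<open>Each product has one linear and one antilinear factor, and \<i> times its conjugate is
  1.\<close>

lemma dz_dzbar_1_1_invariant: "dz_dzbar [i] [j] [\<i> *s v, \<i> *s w] = dz_dzbar [i] [j] [v, w]"
  by (simp add: dz_dzbar_1_1 algebra_simps)

lemma dz_dzbar_eq_0_length: "length vs \<noteq> length I + length J \<Longrightarrow> dz_dzbar I J vs = 0"
  by (simp add: dz_dzbar_def wedge_list_eq_0_length)

lemma sum_length_1: "(\<Sum>I | length I = 1. f I) = (\<Sum>i\<in>UNIV. f [i :: 'n::finite])"
proof -
  have "{I :: 'n list. length I = 1} = range (\<lambda>i. [i])" by (auto simp: length_Suc_conv)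
  then show ?thesis by (simp add: sum.reindex inj_def)
qed

lemma smult_eq_Re_Im: "a *s (v :: complex ^ 'n) = Re a *\<^sub>R v + Im a *\<^sub>R (\<i> *s v)"
  by (simp add: vec_eq_iff complex_eq_iff)

lemma smult_ii: "\<i> *s (\<i> *s (v :: complex ^ 'n)) = - v"
  by (simp add: vec_eq_iff)

text \<open>A common source for the complex linear case \<open>k = \<i>\<close> and the antilinear
  case \<open>k = - \<i>\<close>.\<close>

lemma linear_smult:
  fixes h :: "complex ^ 'n \<Rightarrow> complex"
  assumes "linear h" "\<And>v. h (\<i> *s v) = k * h v"
  shows "h (a *s v) = (of_real (Re a) + k * of_real (Im a)) * h v"
  by (simp add: smult_eq_Re_Im[of a v] linear_add[OF assms(1)] linear_cmul[OF assms(1)] assms(2)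
      scaleR_conv_of_real[where 'a = complex] algebra_simps)

lemma complex_linear_smult:
  fixes h :: "complex ^ 'n \<Rightarrow> complex"
  assumes "linear h" "\<And>v. h (\<i> *s v) = \<i> * h v"
  shows "h (a *s v) = a * h v"
  using linear_smult[OF assms] complex_eq[of a] by simp

lemma complex_antilinear_smult:
  fixes h :: "complex ^ 'n \<Rightarrow> complex"
  assumes "linear h" "\<And>v. h (\<i> *s v) = - \<i> * h v"
  shows "h (a *s v) = cnj a * h v"
proof -
  have "of_real (Re a) + - \<i> * of_real (Im a) = cnj a" by (simp add: complex_eq_iff)
  then show ?thesis using linear_smult[OF assms] by simp
qed

lemma complex_linear_expand:
  fixes h :: "complex ^ 'n::finite \<Rightarrow> complex"
  assumes "linear h" "\<And>v. h (\<i> *s v) = \<i> * h v"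
  shows "h v = (\<Sum>i\<in>UNIV. v $ i * h (axis i 1))"
  using basis_expansion[of v]
  by (metis (no_types, lifting) assms(1) complex_linear_smult[OF assms] linear_sum sum.cong)

lemma complex_antilinear_expand:
  fixes h :: "complex ^ 'n::finite \<Rightarrow> complex"
  assumes "linear h" "\<And>v. h (\<i> *s v) = - \<i> * h v"
  shows "h v = (\<Sum>i\<in>UNIV. cnj (v $ i) * h (axis i 1))"
  using basis_expansion[of v]
  by (metis (no_types, lifting) assms(1) complex_antilinear_smult[OF assms] linear_sum sum.cong)

context complex_atlas
begin

text \<open>Having type (1,0) means being complex linear at each point. In place of the existence of
  coefficients this gives an equation that can be followed through the operators.\<close>

lemma pq_forms_1_0_iff:
  "\<omega> \<in> pq_forms \<A> 1 0 \<longleftrightarrow> \<omega> \<in> forms \<A> 1 \<and> (\<forall>c x v. \<omega> c x [\<i> *s v] = \<i> * \<omega> c x [v])"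
  (is "?l \<longleftrightarrow> ?f \<and> ?r")
proof (intro iffI conjI)
  assume l: ?l
  then show f: ?f by (simp add: pq_forms_def)
  show ?r
  proof (intro allI)
    fix c x v
    show "\<omega> c x [\<i> *s v] = \<i> * \<omega> c x [v]"
    proof (cases "c \<in> \<A> \<and> x \<in> chart_image c")
      case True
      then obtain a where "\<And>vs. \<omega> c x vs = (\<Sum>I | length I = 1. \<Sum>J | length J = 0. a I J * dz_dzbar I J vs)"
        using l unfolding pq_forms_def by blast
      then show ?thesis by (simp add: sum_length_1[unfolded One_nat_def] dz_dzbar_1_0 sum_distrib_left mult.left_commute)
    qed (use forms_eq_0_outside[OF f] in auto)
  qed
next
  assume fr: "?f \<and> ?r"
  \<comment> \<open>The coefficient of the i-th \<open>dz\<close> is the value on the i-th standard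
    basis vector; \<open>hd I\<close> is the only entry of \<open>I\<close>.\<close>
  have "\<omega> c x vs = (\<Sum>I | length I = 1. \<Sum>J | length J = 0. \<omega> c x [axis (hd I) 1] * dz_dzbar I J vs)"
    for c x vs
  proof (cases "length vs = 1")
    case True
    then obtain v where v: "vs = [v]" by (auto simp: length_Suc_conv)
    show ?thesis
      using complex_linear_expand[OF forms_1_linear, of \<omega> \<A> c x v] fr
      by (simp add: v sum_length_1[unfolded One_nat_def] dz_dzbar_1_0 mult.commute)
  next
    case False
    then show ?thesis
      using forms_eq_0_length[of \<omega> \<A> 1 vs] fr
      by (simp add: sum_length_1[unfolded One_nat_def] dz_dzbar_eq_0_length)
  qed
  then have "\<exists>a. \<forall>vs. \<omega> c x vs = (\<Sum>I | length I = 1. \<Sum>J | length J = 0. a I J * dz_dzbar I J vs)" for c x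
    by (intro exI[of _ "\<lambda>I J. \<omega> c x [axis (hd I) 1]"] allI)
  then show ?l
    unfolding pq_forms_def mem_Collect_eq by (intro conjI ballI) (use fr in simp)
qed

lemma pq_forms_0_1_iff:
  "\<omega> \<in> pq_forms \<A> 0 1 \<longleftrightarrow> \<omega> \<in> forms \<A> 1 \<and> (\<forall>c x v. \<omega> c x [\<i> *s v] = - \<i> * \<omega> c x [v])"
  (is "?l \<longleftrightarrow> ?f \<and> ?r")
proof (intro iffI conjI)
  assume l: ?l
  then show f: ?f by (simp add: pq_forms_def)
  show ?r
  proof (intro allI)
    fix c x v
    show "\<omega> c x [\<i> *s v] = - \<i> * \<omega> c x [v]"
    proof (cases "c \<in> \<A> \<and> x \<in> chart_image c")
      case True
      then obtain a where "\<And>vs. \<omega> c x vs = (\<Sum>I | length I = 0. \<Sum>J | length J = 1. a I J * dz_dzbar I J vs)"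
        using l unfolding pq_forms_def by blast
      then show ?thesis
        by (simp add: sum_length_1[unfolded One_nat_def] dz_dzbar_0_1 sum_distrib_left mult.left_commute sum_negf)
    qed (use forms_eq_0_outside[OF f] in auto)
  qed
next
  assume fr: "?f \<and> ?r"
  have "\<omega> c x vs = (\<Sum>I | length I = 0. \<Sum>J | length J = 1. \<omega> c x [axis (hd J) 1] * dz_dzbar I J vs)"
    for c x vs
  proof (cases "length vs = 1")
    case True
    then obtain v where v: "vs = [v]" by (auto simp: length_Suc_conv)
    show ?thesis
      using complex_antilinear_expand[OF forms_1_linear, of \<omega> \<A> c x v] fr
      by (simp add: v sum_length_1[unfolded One_nat_def] dz_dzbar_0_1 mult.commute)
  next
    case False
    then show ?thesis
      using forms_eq_0_length[of \<omega> \<A> 1 vs] fr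
      by (simp add: sum_length_1[unfolded One_nat_def] dz_dzbar_eq_0_length)
  qed
  then have "\<exists>a. \<forall>vs. \<omega> c x vs = (\<Sum>I | length I = 0. \<Sum>J | length J = 1. a I J * dz_dzbar I J vs)" for c x
    by (intro exI[of _ "\<lambda>I J. \<omega> c x [axis (hd J) 1]"] allI)
  then show ?l
    unfolding pq_forms_def mem_Collect_eq by (intro conjI ballI) (use fr in simp)
qed

text \<open>Multiplying both arguments by \<i> fixes (1,1)-forms and changes the sign of (2,0)- and
  (0,2)-forms, so invariance singles out type (1,1).\<close>

lemma pq_forms_1_1_iff:
  "\<omega> \<in> pq_forms \<A> 1 1 \<longleftrightarrow>
    \<omega> \<in> forms \<A> 2 \<and> (\<forall>c x v w. \<omega> c x [\<i> *s v, \<i> *s w] = \<omega> c x [v, w])"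
  (is "?l \<longleftrightarrow> ?f \<and> ?r")
proof (intro iffI conjI)
  assume l: ?l
  then show f: ?f by (simp add: pq_forms_def one_add_one[symmetric] del: one_add_one)
  show ?r
  proof (intro allI)
    fix c x v w
    show "\<omega> c x [\<i> *s v, \<i> *s w] = \<omega> c x [v, w]"
    proof (cases "c \<in> \<A> \<and> x \<in> chart_image c")
      case True
      then obtain a where "\<And>vs. \<omega> c x vs = (\<Sum>I | length I = 1. \<Sum>J | length J = 1. a I J * dz_dzbar I J vs)"
        using l unfolding pq_forms_def by blast
      then show ?thesis by (simp add: dz_dzbar_1_1_invariant sum_length_1[unfolded One_nat_def])
    qed (use forms_eq_0_outside[OF f] in auto)
  qed
next
  assume fr: "?f \<and> ?r"
  then have f: "\<omega> \<in> forms \<A> 2" and r: "\<omega> c x [\<i> *s v, \<i> *s w] = \<omega> c x [v, w]" for c x v w by blast+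
  \<comment> \<open>The part of \<omega> that is complex linear in the first argument. By invariance
    it is antilinear in the second, so its values on basis vectors serve as the coefficients of the
    form.\<close>
  define h where "h c x v w = (\<omega> c x [v, w] - \<i> * \<omega> c x [\<i> *s v, w]) / 2" for c x v w
  note l1 = forms_2_linear(1)[OF f] and l2 = forms_2_linear(2)[OF f]
  have lin1: "linear (\<lambda>v. h c x v w)" for c x w
    using l1[of c x w] unfolding linear_iff h_def
    by (simp add: smult.add_right smult.scaleR_right scaleR_conv_of_real[where 'a = complex] algebra_simps add_divide_distrib diff_divide_distrib)
  have lin2: "linear (\<lambda>w. h c x v w)" for c x v
    using l2[of c x] unfolding linear_iff h_def
    by (simp add: scaleR_conv_of_real[where 'a = complex] algebra_simps add_divide_distrib diff_divide_distrib)
  have neg1: "\<omega> c x [- v, w] = - \<omega> c x [v, w]" for c x v w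
    by (rule linear_neg[OF l1])
  have neg2: "\<omega> c x [v, - w] = - \<omega> c x [v, w]" for c x v w
    by (rule linear_neg[OF l2])
  have h1: "h c x (\<i> *s v) w = \<i> * h c x v w" for c x v w
    by (simp add: h_def smult_ii neg1 field_simps)
  have r': "\<omega> c x [v, \<i> *s w] = - \<omega> c x [\<i> *s v, w]" for c x v w
    using r[of c x v "\<i> *s w"] by (simp add: smult_ii neg2)
  have h2: "h c x v (\<i> *s w) = - \<i> * h c x v w" for c x v w
    by (simp add: h_def r' smult_ii neg1 field_simps)
  \<comment> \<open>The remaining part of \<omega>, antilinear in the first argument, is recovered
    from \<open>h\<close> by antisymmetry.\<close>
  have w_h: "\<omega> c x [v, w] = h c x v w - h c x w v" for c x v w
    using r'[of c x w v] forms_2_antisym[OF f, of c x v w] forms_2_antisym[OF f, of c x "\<i> *s v" w]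
    by (simp add: h_def r' field_simps)
  have h_exp: "h c x v w = (\<Sum>i\<in>UNIV. \<Sum>j\<in>UNIV. h c x (axis i 1) (axis j 1) * (v $ i * cnj (w $ j)))" for c x v w
  proof -
    have "h c x v w = (\<Sum>i\<in>UNIV. v $ i * h c x (axis i 1) w)"
      by (rule complex_linear_expand[OF lin1 h1])
    also have "\<dots> = (\<Sum>i\<in>UNIV. v $ i * (\<Sum>j\<in>UNIV. cnj (w $ j) * h c x (axis i 1) (axis j 1)))"
      by (simp only: complex_antilinear_expand[OF lin2 h2, of _ _ _ w])
    finally show ?thesis by (simp add: sum_distrib_left algebra_simps)
  qed
  have "\<omega> c x vs = (\<Sum>I | length I = 1. \<Sum>J | length J = 1. h c x (axis (hd I) 1) (axis (hd J) 1) * dz_dzbar I J vs)"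
    for c x vs
  proof (cases "length vs = 2")
    case True
    then obtain v w where v: "vs = [v, w]" by (auto simp: length_2_iff)
    show ?thesis
      by (simp add: v sum_length_1[unfolded One_nat_def] dz_dzbar_1_1 w_h[of c x v w] h_exp[of c x v w] h_exp[of c x w v]
          right_diff_distrib flip: sum_subtractf)
  next
    case False
    then show ?thesis
      using forms_eq_0_length[OF f, of vs]
      by (simp add: sum_length_1[unfolded One_nat_def] dz_dzbar_eq_0_length)
  qed
  then have "\<exists>a. \<forall>vs. \<omega> c x vs = (\<Sum>I | length I = 1. \<Sum>J | length J = 1. a I J * dz_dzbar I J vs)" for c x
    by (intro exI[of _ "\<lambda>I J. h c x (axis (hd I) 1) (axis (hd J) 1)"] allI)
  then show ?l
    unfolding pq_forms_def mem_Collect_eq by (intro conjI ballI) (use f in \<open>simp add: numeral_2_eq_2\<close>)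
qed

end

section \<open>Quotients of groups of forms\<close>

text \<open>Subgroups and additivity are phrased with the pointwise operations on functions, keeping
  computations with forms free of the monoid records, which enter only through
  \<open>form_group\<close>.\<close>

definition add_subgroup :: "'g::ab_group_add set \<Rightarrow> bool" where
  "add_subgroup Z \<longleftrightarrow> 0 \<in> Z \<and> (\<forall>x\<in>Z. \<forall>y\<in>Z. x + y \<in> Z) \<and> (\<forall>x\<in>Z. - x \<in> Z)"

definition additive_on :: "('g::ab_group_add \<Rightarrow> 'h::ab_group_add) \<Rightarrow> 'g set \<Rightarrow> bool" where
  "additive_on f Z \<longleftrightarrow> (\<forall>x\<in>Z. \<forall>y\<in>Z. f (x + y) = f x + f y)"

lemma add_subgroup_diff: "\<lbrakk>add_subgroup Z; x \<in> Z; y \<in> Z\<rbrakk> \<Longrightarrow> x - y \<in> Z"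
  unfolding add_subgroup_def by (metis uminus_add_conv_diff add.commute)

lemma additive_on_subset: "\<lbrakk>additive_on f Z; Y \<subseteq> Z\<rbrakk> \<Longrightarrow> additive_on f Y"
  unfolding additive_on_def by blast

lemma additive_on_zero: "\<lbrakk>additive_on f Z; 0 \<in> Z\<rbrakk> \<Longrightarrow> f 0 = 0"
  unfolding additive_on_def by (metis add_0 add_cancel_left_left)

lemma additive_on_minus: "\<lbrakk>additive_on f Z; add_subgroup Z; x \<in> Z\<rbrakk> \<Longrightarrow> f (- x) = - f x"
  using additive_on_zero[of f Z] unfolding additive_on_def add_subgroup_def
  by (metis add.right_inverse eq_neg_iff_add_eq_0 add.commute)

lemma add_subgroup_kernel:
  assumes "add_subgroup Z" "additive_on f Z"
  shows "add_subgroup {x \<in> Z. f x = 0}"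
  using assms additive_on_zero[OF assms(2)] additive_on_minus[OF assms(2,1)]
  unfolding add_subgroup_def additive_on_def by simp

lemma add_subgroup_image:
  assumes "add_subgroup Z" "additive_on f Z"
  shows "add_subgroup (f ` Z)"
  unfolding add_subgroup_def
proof (intro conjI ballI)
  show "0 \<in> f ` Z"
    using additive_on_zero[OF assms(2)] assms(1) unfolding add_subgroup_def by force
  fix x assume "x \<in> f ` Z"
  then obtain a where a: "a \<in> Z" "x = f a" by blast
  then have "- a \<in> Z" using assms(1) by (simp add: add_subgroup_def)
  then show "- x \<in> f ` Z"
    using a additive_on_minus[OF assms(2,1) a(1)] by (metis imageI)
  fix y assume "y \<in> f ` Z"
  then obtain b where b: "b \<in> Z" "y = f b" by blast
  then have "a + b \<in> Z" using a assms(1) by (simp add: add_subgroup_def)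
  moreover have "x + y = f (a + b)" using a b assms(2) by (simp add: additive_on_def)
  ultimately show "x + y \<in> f ` Z" by blast
qed

lemma form_group_simps [simp]:
  "carrier (form_group Z) = Z" "x \<otimes>\<^bsub>form_group Z\<^esub> y = x + y" "\<one>\<^bsub>form_group Z\<^esub> = 0"
  by (simp_all add: form_group_def)

lemma comm_group_form_group:
  assumes "add_subgroup Z"
  shows "comm_group (form_group Z)"
proof (rule comm_groupI)
  show "\<exists>y\<in>carrier (form_group Z). y \<otimes>\<^bsub>form_group Z\<^esub> x = \<one>\<^bsub>form_group Z\<^esub>"
    if "x \<in> carrier (form_group Z)" for x
    using that assms by (intro bexI[of _ "- x"]) (auto simp: add_subgroup_def)
qed (use assms in \<open>auto simp: add_subgroup_def algebra_simps\<close>)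

lemma normal_form_group:
  assumes "add_subgroup Z" "add_subgroup N" "N \<subseteq> Z"
  shows "N \<lhd> form_group Z"
proof -
  interpret comm_group "form_group Z" by (rule comm_group_form_group[OF assms(1)])
  have inv: "inv\<^bsub>form_group Z\<^esub> x = - x" if "x \<in> Z" for x
    using that assms(1) by (intro inv_equality) (auto simp: add_subgroup_def)
  have "subgroup N (form_group Z)"
    using assms(2,3) inv by (intro subgroupI) (auto simp: add_subgroup_def)
  then show ?thesis by (rule subgroup_imp_normal)
qed

abbreviation coset :: "'g::ab_group_add set \<Rightarrow> 'g \<Rightarrow> 'g set" where
  "coset N z \<equiv> (\<lambda>n. n + z) ` N"

lemma r_coset_form_group: "N #>\<^bsub>form_group Z\<^esub> z = coset N z"
  by (auto simp: r_coset_def)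

lemma carrier_form_group_Mod: "carrier (form_group Z Mod N) = coset N ` Z"
  by (auto simp: FactGroup_def RCOSETS_def r_coset_form_group)

lemma one_form_group_Mod: "\<one>\<^bsub>form_group Z Mod N\<^esub> = coset N 0"
  by (simp add: FactGroup_def)

lemma coset_eq_iff:
  assumes "add_subgroup N"
  shows "coset N z = coset N w \<longleftrightarrow> z - w \<in> N"
proof
  assume "coset N z = coset N w"
  moreover have "z \<in> coset N z" using assms by (force simp: add_subgroup_def)
  ultimately obtain n where "n \<in> N" "z = n + w" by auto
  then show "z - w \<in> N" by simp
next
  assume zw: "z - w \<in> N"
  then have wz: "w - z \<in> N" using assms unfolding add_subgroup_def by (metis minus_diff_eq)
  show "coset N z = coset N w"
  proof (intro equalityI image_subsetI)
    fix n assume n: "n \<in> N"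
    show "n + z \<in> coset N w"
      by (rule image_eqI[of _ _ "n + (z - w)"]) (use n zw assms in \<open>auto simp: add_subgroup_def\<close>)
    show "n + w \<in> coset N z"
      by (rule image_eqI[of _ _ "n + (w - z)"]) (use n wz assms in \<open>auto simp: add_subgroup_def\<close>)
  qed
qed

lemma mult_form_group_Mod:
  assumes "add_subgroup N"
  shows "coset N z \<otimes>\<^bsub>form_group Z Mod N\<^esub> coset N w = coset N (z + w)"
proof -
  have "coset N z \<otimes>\<^bsub>form_group Z Mod N\<^esub> coset N w = (\<Union>m\<in>N. \<Union>n\<in>N. {(m + z) + (n + w)})"
    by (simp add: FactGroup_def set_mult_def)
  also have "\<dots> = coset N (z + w)"
  proof (intro equalityI subsetI)
    fix x assume "x \<in> (\<Union>m\<in>N. \<Union>n\<in>N. {(m + z) + (n + w)})"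
    then obtain m n where "m \<in> N" "n \<in> N" "x = (m + n) + (z + w)" by (auto simp: algebra_simps)
    then show "x \<in> coset N (z + w)" using assms by (auto simp: add_subgroup_def)
  next
    fix x assume "x \<in> coset N (z + w)"
    then obtain m where "m \<in> N" "x = (m + z) + (0 + w)" by (auto simp: algebra_simps)
    then show "x \<in> (\<Union>m\<in>N. \<Union>n\<in>N. {(m + z) + (n + w)})"
      using assms unfolding add_subgroup_def by blast
  qed
  finally show ?thesis .
qed

lemma group_form_group_Mod:
  assumes "add_subgroup Z" "add_subgroup N" "N \<subseteq> Z"
  shows "group (form_group Z Mod N)"
  using normal.factorgroup_is_group[OF normal_form_group[OF assms]] .

text \<open>Representatives differ by elements of \<open>N\<close>, whose images lie in
  \<open>N'\<close>; all cosets in the union that defines \<open>induced_map\<close> coincide, so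
  the map is well defined on the class.\<close>

lemma induced_map_coset:
  assumes "additive_on f Z" "add_subgroup N" "N \<subseteq> Z" "z \<in> Z" "add_subgroup N'" "f ` N \<subseteq> N'"
  shows "induced_map Z' N' f (coset N z) = coset N' (f z)"
proof -
  have "coset N' (f (n + z)) = coset N' (f z)" if "n \<in> N" for n
    using assms that by (auto simp: coset_eq_iff additive_on_def subset_iff)
  moreover have "N \<noteq> {}" using assms(2) by (auto simp: add_subgroup_def)
  ultimately show ?thesis
    by (simp add: induced_map_def r_coset_form_group)
qed

section \<open>Exactness\<close>

context complex_atlas
begin

text \<open>Transition derivatives are complex linear, so multiplying the argument by \<i> is
  compatible with pullback and acts on global 1-forms. The two parameters cover both type
  projections.\<close>

lemma form_1_comp_i:
  assumes "\<gamma> \<in> forms \<A> 1"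
  shows "(\<lambda>c x vs. a * \<gamma> c x vs + b * \<gamma> c x (map ((*s) \<i>) vs)) \<in> forms \<A> 1" (is "?w \<in> _")
proof (rule forms_1I)
  note lin = forms_1_linear[OF assms]
  show "a * \<gamma> c x vs + b * \<gamma> c x (map ((*s) \<i>) vs) = 0" if "length vs \<noteq> 1 \<or> c \<notin> \<A> \<or> x \<notin> chart_image c" for c x vs
    using that forms_eq_0_length[OF assms, of vs c x] forms_eq_0_length[OF assms, of "map ((*s) \<i>) vs" c x]
      forms_eq_0_outside[OF assms, of c x vs] forms_eq_0_outside[OF assms, of c x "map ((*s) \<i>) vs"]
    by auto
  show "linear (\<lambda>v. a * \<gamma> c x [v] + b * \<gamma> c x (map ((*s) \<i>) [v]))" for c x
    using lin[of c x]
    by (simp add: linear_iff smult.add_right smult.scaleR_right scaleR_conv_of_real[where 'a = complex] algebra_simps)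
  show "smooth_on (\<lambda>x. a * \<gamma> c x [v] + b * \<gamma> c x (map ((*s) \<i>) [v])) (chart_image c)" if "c \<in> \<A>" for c v
    by (intro smooth_on_add smooth_on_mult smooth_on_const open_chart_image forms_smooth[OF assms] that)
  show "a * \<gamma> c (snd c p) [v] + b * \<gamma> c (snd c p) (map ((*s) \<i>) [v]) =
      a * \<gamma> d (snd d p) [dir_deriv v (transition c d) (snd c p)]
      + b * \<gamma> d (snd d p) (map ((*s) \<i>) [dir_deriv v (transition c d) (snd c p)])"
    if c: "c \<in> \<A>" and d: "d \<in> \<A>" and p: "p \<in> fst c" "p \<in> fst d" for c d p v
    using forms_transition[OF assms c d, of p "[v]"] forms_transition[OF assms c d, of p "[\<i> *s v]"] p
      holomorphic_map_on_dir_deriv_smult[OF transition_holomorphic[OF c d], of "snd c p" \<i> v]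
    by simp
qed

lemma form_1_decompose:
  assumes "\<gamma> \<in> forms \<A> 1"
  obtains \<beta> \<alpha> where "\<beta> \<in> pq_forms \<A> 1 0" "\<alpha> \<in> pq_forms \<A> 0 1" "\<gamma> = \<beta> + \<alpha>"
proof
  have neg: "\<gamma> c x [- v] = - \<gamma> c x [v]" for c x v
    by (rule linear_neg[OF forms_1_linear[OF assms]])
  \<comment> \<open>The type projections of \<gamma>: \<open>b = -\<i>/2\<close> gives the
    (1,0)-part, \<open>b = \<i>/2\<close> the (0,1)-part.\<close>
  let ?w = "\<lambda>b c x vs. (1/2) * \<gamma> c x vs + b * \<gamma> c x (map ((*s) \<i>) vs)"
  show "?w (-\<i>/2) \<in> pq_forms \<A> 1 0"
    unfolding pq_forms_1_0_iff by (intro conjI allI form_1_comp_i[OF assms]) (simp add: smult_ii neg field_simps)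
  show "?w (\<i>/2) \<in> pq_forms \<A> 0 1"
    unfolding pq_forms_0_1_iff by (intro conjI allI form_1_comp_i[OF assms]) (simp add: smult_ii neg field_simps)
  show "\<gamma> = ?w (-\<i>/2) + ?w (\<i>/2)"
    by (intro ext) simp
qed

lemma add_subgroup_forms: "add_subgroup (forms \<A> k)"
  unfolding add_subgroup_def using forms_zero forms_add forms_uminus by blast

lemma add_subgroup_pq_forms:
  "add_subgroup (pq_forms \<A> 1 0)" "add_subgroup (pq_forms \<A> 0 1)" "add_subgroup (pq_forms \<A> 1 1)"
proof -
  have *: "pq_forms \<A> 1 0 = {\<omega>. \<omega> \<in> forms \<A> 1 \<and> (\<forall>c x v. \<omega> c x [\<i> *s v] = \<i> * \<omega> c x [v])}"
    "pq_forms \<A> 0 1 = {\<omega>. \<omega> \<in> forms \<A> 1 \<and> (\<forall>c x v. \<omega> c x [\<i> *s v] = - \<i> * \<omega> c x [v])}"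
    "pq_forms \<A> 1 1 = {\<omega>. \<omega> \<in> forms \<A> 2 \<and> (\<forall>c x v w. \<omega> c x [\<i> *s v, \<i> *s w] = \<omega> c x [v, w])}"
    using pq_forms_1_0_iff pq_forms_0_1_iff pq_forms_1_1_iff by blast+
  show "add_subgroup (pq_forms \<A> 1 0)" "add_subgroup (pq_forms \<A> 0 1)" "add_subgroup (pq_forms \<A> 1 1)"
    unfolding add_subgroup_def * by (simp_all add: forms_zero forms_add forms_uminus algebra_simps)
qed

end

section \<open>Types of derivatives, and the maps induced on cohomology\<close>

context flat_line_bundle
begin

abbreviation "del \<equiv> del_theta \<theta>"
abbreviation "delbar \<equiv> delbar_theta \<theta>"

lemma additive_on_del: "additive_on del (forms \<A> k)"
  and additive_on_delbar: "additive_on delbar (forms \<A> k)"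
  and additive_on_d: "additive_on (d_theta \<theta>) (forms \<A> k)"
  unfolding additive_on_def del_theta_eq_conn delbar_theta_eq_conn d_theta_eq_conn
  using conn_add by blast+

text \<open>Anticommutation of an operator with itself yields twice its square; this removes the
  factor 2.\<close>

lemma form_double_eq_0: "\<omega> + \<omega> = 0 \<Longrightarrow> \<omega> = (0 :: ('a, 'n) form)"
proof (intro ext)
  fix c x vs assume "\<omega> + \<omega> = 0"
  then have "(\<omega> + \<omega>) c x vs = 0" by simp
  then show "\<omega> c x vs = 0 c x vs" by simp
qed

lemma del_delbar_form:
  "f \<in> forms \<A> 0 \<Longrightarrow> del f \<in> forms \<A> 1" "f \<in> forms \<A> 0 \<Longrightarrow> delbar f \<in> forms \<A> 1"
  "\<omega> \<in> forms \<A> 1 \<Longrightarrow> del \<omega> \<in> forms \<A> 2" "\<omega> \<in> forms \<A> 1 \<Longrightarrow> delbar \<omega> \<in> forms \<A> 2"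
  "\<omega> \<in> forms \<A> 1 \<Longrightarrow> d_theta \<theta> \<omega> \<in> forms \<A> 2"
  unfolding del_theta_eq_conn delbar_theta_eq_conn d_theta_eq_conn
  by (simp_all only: conn_form_1 conn_form_2)

lemma del_del:
  assumes "\<omega> \<in> forms \<A> 0 \<or> \<omega> \<in> forms \<A> 1"
  shows "del (del \<omega>) = 0" "delbar (delbar \<omega>) = 0" "d_theta \<theta> (d_theta \<theta> \<omega>) = 0"
    "delbar (del \<omega>) = - del (delbar \<omega>)"
proof -
  have anti: "conn a b \<theta> (conn a' b' \<theta> \<omega>) + conn a' b' \<theta> (conn a b \<theta> \<omega>) = 0" for a b a' b'
    using assms conn_anticommute_0 conn_anticommute_1 by blast
  show "del (del \<omega>) = 0" "delbar (delbar \<omega>) = 0" "d_theta \<theta> (d_theta \<theta> \<omega>) = 0"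
    unfolding del_theta_eq_conn delbar_theta_eq_conn d_theta_eq_conn
    using form_double_eq_0[OF anti] by blast+
  show "delbar (del \<omega>) = - del (delbar \<omega>)"
    unfolding del_theta_eq_conn delbar_theta_eq_conn
    using anti by (simp only: eq_neg_iff_add_eq_0)
qed

text \<open>The (1,0)- and (0,1)-parts of a tangent vector are multiplied by \<i> and
  \<open>- \<i>\<close> when the vector is multiplied by \<i>.\<close>

lemma pcov_smult_i:
  assumes "x \<in> chart_image c" "smooth_on f (chart_image c)"
  shows "P (1/2) (-\<i>/2) c (\<i> *s v) f x = \<i> * P (1/2) (-\<i>/2) c v f x"
    and "P (1/2) (\<i>/2) c (\<i> *s v) f x = - \<i> * P (1/2) (\<i>/2) c v f x"
  using linear_neg[OF cov_linear[OF assms], of v] by (simp_all add: pcov_def smult_ii algebra_simps)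

lemma del_form_0_type:
  assumes f: "f \<in> forms \<A> 0"
  shows "del f \<in> pq_forms \<A> 1 0" "delbar f \<in> pq_forms \<A> 0 1"
proof -
  have "del f c x [\<i> *s v] = \<i> * del f c x [v]" "delbar f c x [\<i> *s v] = - \<i> * delbar f c x [v]" for c x v
  proof (atomize (full), cases "c \<in> \<A> \<and> x \<in> chart_image c")
    case True
    then show "del f c x [\<i> *s v] = \<i> * del f c x [v] \<and> delbar f c x [\<i> *s v] = - \<i> * delbar f c x [v]"
      unfolding del_theta_eq_conn delbar_theta_eq_conn
      using pcov_smult_i[of x c "\<lambda>y. f c y []" v] forms_smooth[OF f, of c "[]"] conn_0_apply[OF f, of c x] by simp
  qed (use forms_eq_0_outside[OF del_delbar_form(1)[OF f]] forms_eq_0_outside[OF del_delbar_form(2)[OF f]] in simp)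
  then show "del f \<in> pq_forms \<A> 1 0" "delbar f \<in> pq_forms \<A> 0 1"
    unfolding pq_forms_1_0_iff pq_forms_0_1_iff using del_delbar_form(1,2)[OF f] by blast+
qed

text \<open>Each of the two terms has one argument as direction of differentiation, contributing
  \<open>t\<close>, and one as argument of \<omega>, contributing \<open>s\<close>. The roles are
  exchanged between the terms, so multiplying a single argument gives a common factor when
  \<open>s = t\<close>.\<close>

lemma conn_form_1_type:
  assumes \<omega>: "\<omega> \<in> forms \<A> 1" and s: "\<And>c x v. \<omega> c x [\<i> *s v] = s * \<omega> c x [v]"
    and t: "\<And>c x v f. \<lbrakk>x \<in> chart_image c; smooth_on f (chart_image c)\<rbrakk> \<Longrightarrow> P a b c (\<i> *s v) f x = t * P a b c v f x"
  shows "conn a b \<theta> \<omega> c x [\<i> *s v, \<i> *s w] = (t * s) * conn a b \<theta> \<omega> c x [v, w]" (is ?A)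
    and "s = t \<Longrightarrow> conn a b \<theta> \<omega> c x [\<i> *s v, w] = t * conn a b \<theta> \<omega> c x [v, w]" (is "_ \<Longrightarrow> ?B")
proof -
  have "?A \<and> (s = t \<longrightarrow> ?B)"
  proof (cases "c \<in> \<A> \<and> x \<in> chart_image c")
    case True
    then have c: "c \<in> \<A>" and x: "x \<in> chart_image c" by auto
    note sm = forms_smooth[OF \<omega> c]
    have 1: "P a b c (\<i> *s v) (\<lambda>y. \<omega> c y [w]) x = t * P a b c v (\<lambda>y. \<omega> c y [w]) x" for v w
      by (rule t[OF x sm])
    have 2: "P a b c v (\<lambda>y. \<omega> c y [\<i> *s w]) x = s * P a b c v (\<lambda>y. \<omega> c y [w]) x" for v w
      unfolding s by (rule pcov_cmult[OF x sm])
    show ?thesis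
      unfolding conn_1_apply[OF \<omega> c x] 1 2 by (simp add: algebra_simps)
  qed (use forms_eq_0_outside[OF conn_form_2[OF \<omega>]] in simp)
  then show ?A "s = t \<Longrightarrow> ?B" by blast+
qed

text \<open>For mixed types the two factors multiply to 1, which is the criterion for (1,1). The
  last two claims express the types (2,0) and (0,2) through the first argument.\<close>

lemma del_form_1_type:
  assumes "\<alpha> \<in> pq_forms \<A> 0 1" "\<beta> \<in> pq_forms \<A> 1 0"
  shows "del \<alpha> \<in> pq_forms \<A> 1 1" "delbar \<beta> \<in> pq_forms \<A> 1 1"
    "del \<beta> c x [\<i> *s v, w] = \<i> * del \<beta> c x [v, w]"
    "delbar \<alpha> c x [\<i> *s v, w] = - \<i> * delbar \<alpha> c x [v, w]"
proof -
  have \<alpha>: "\<alpha> \<in> forms \<A> 1" "\<And>c x v. \<alpha> c x [\<i> *s v] = - \<i> * \<alpha> c x [v]"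
    using assms(1) unfolding pq_forms_0_1_iff by blast+
  have \<beta>: "\<beta> \<in> forms \<A> 1" "\<And>c x v. \<beta> c x [\<i> *s v] = \<i> * \<beta> c x [v]"
    using assms(2) unfolding pq_forms_1_0_iff by blast+
  show "del \<alpha> \<in> pq_forms \<A> 1 1"
    unfolding pq_forms_1_1_iff using del_delbar_form(3)[OF \<alpha>(1)]
      conn_form_1_type(1)[OF \<alpha> pcov_smult_i(1)] by (simp add: del_theta_eq_conn)
  show "delbar \<beta> \<in> pq_forms \<A> 1 1"
    unfolding pq_forms_1_1_iff using del_delbar_form(4)[OF \<beta>(1)]
      conn_form_1_type(1)[OF \<beta> pcov_smult_i(2)] by (simp add: delbar_theta_eq_conn)
  show "del \<beta> c x [\<i> *s v, w] = \<i> * del \<beta> c x [v, w]"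
    unfolding del_theta_eq_conn by (rule conn_form_1_type(2)[OF \<beta> pcov_smult_i(1) refl])
  show "delbar \<alpha> c x [\<i> *s v, w] = - \<i> * delbar \<alpha> c x [v, w]"
    unfolding delbar_theta_eq_conn by (rule conn_form_1_type(2)[OF \<alpha> pcov_smult_i(2) refl])
qed

text \<open>Multiplying both arguments by \<i> multiplies \<open>T\<close> and \<open>S\<close> by
  -1 but fixes \<eta>, so \<open>T + S\<close> vanishes; multiplying only one argument then
  separates \<open>T\<close> from \<open>S\<close>.\<close>

lemma forms_2_sum_type_eq_0:
  assumes \<eta>: "\<eta> \<in> pq_forms \<A> 1 1" "\<eta> = T + S" and T: "T \<in> forms \<A> 2" and S: "S \<in> forms \<A> 2"
    and Ti: "\<And>c x v w. T c x [\<i> *s v, w] = \<i> * T c x [v, w]"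
    and Si: "\<And>c x v w. S c x [\<i> *s v, w] = - \<i> * S c x [v, w]"
  shows "T = 0" "S = 0"
proof -
  have Ti2: "T c x [v, \<i> *s w] = \<i> * T c x [v, w]" and Si2: "S c x [v, \<i> *s w] = - \<i> * S c x [v, w]" for c x v w
    using Ti[of c x w v] Si[of c x w v] forms_2_antisym[OF T, of c x] forms_2_antisym[OF S, of c x]
    by (metis mult_minus_right)+
  have sum: "T c x [v, w] + S c x [v, w] = 0" for c x v w
  proof -
    have "\<eta> c x [\<i> *s v, \<i> *s w] = \<eta> c x [v, w]"
      using \<eta>(1) unfolding pq_forms_1_1_iff by blast
    then have "2 * (T c x [v, w] + S c x [v, w]) = 0"
      unfolding \<eta>(2) plus_fun_apply Ti Si Ti2 Si2 by (simp add: algebra_simps)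
    then show ?thesis by (metis mult_eq_0_iff zero_neq_numeral)
  qed
  have "T c x [v, w] = 0 \<and> S c x [v, w] = 0" for c x v w
  proof -
    \<comment> \<open>The vanishing of \<open>T + S\<close> on \<open>[\<i> *s v, w]\<close>, where
      the two summands acquire opposite factors.\<close>
    have "\<i> * (T c x [v, w] - S c x [v, w]) = 0"
      using sum[of c x "\<i> *s v" w] unfolding Ti Si by (simp add: algebra_simps)
    then have eq: "T c x [v, w] = S c x [v, w]" by simp
    then show ?thesis using sum[of c x v w] by simp
  qed
  then have "T c x vs = 0" "S c x vs = 0" for c x vs
    using forms_eq_0_length[OF T, of vs c x] forms_eq_0_length[OF S, of vs c x]
    by (cases "length vs = 2"; auto simp: length_2_iff)+
  then show "T = 0" "S = 0" by (simp_all add: fun_eq_iff)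
qed

text \<open>Comparing types in \<open>\<eta> = d_theta \<theta> \<gamma>\<close> for \<open>\<eta>\<close> of type \<open>(1,1)\<close>.\<close>

lemma exact_1_1_decompose:
  assumes \<eta>: "\<eta> \<in> pq_forms \<A> 1 1" "\<eta> = d_theta \<theta> \<gamma>" and \<gamma>: "\<gamma> \<in> forms \<A> 1"
  obtains \<alpha> \<beta> where "\<alpha> \<in> pq_forms \<A> 0 1" "delbar \<alpha> = 0" "\<beta> \<in> pq_forms \<A> 1 0" "del \<beta> = 0"
    "\<eta> = del \<alpha> + delbar \<beta>"
proof -
  obtain \<beta> \<alpha> where \<beta>: "\<beta> \<in> pq_forms \<A> 1 0" and \<alpha>: "\<alpha> \<in> pq_forms \<A> 0 1" and g: "\<gamma> = \<beta> + \<alpha>"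
    using form_1_decompose[OF \<gamma>] .
  have \<beta>1: "\<beta> \<in> forms \<A> 1" and \<alpha>1: "\<alpha> \<in> forms \<A> 1"
    using \<beta> \<alpha> unfolding pq_forms_1_0_iff pq_forms_0_1_iff by blast+
  have "\<eta> = (del \<beta> + del \<alpha>) + (delbar \<beta> + delbar \<alpha>)"
    using additive_on_del[of 1] additive_on_delbar[of 1] \<alpha>1 \<beta>1
    unfolding \<eta>(2) g d_theta_eq additive_on_def by metis
  \<comment> \<open>The left side has type (1,1), the right side is a (2,0)-form plus a (0,2)-form;
    hence both summands on the right vanish.\<close>
  then have eq: "\<eta> - (del \<alpha> + delbar \<beta>) = del \<beta> + delbar \<alpha>" by simp
  have "\<eta> - (del \<alpha> + delbar \<beta>) \<in> pq_forms \<A> 1 1"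
    using add_subgroup_diff[OF add_subgroup_pq_forms(3) \<eta>(1)] add_subgroup_pq_forms(3)
      del_form_1_type(1,2)[OF \<alpha> \<beta>] unfolding add_subgroup_def by blast
  note z = forms_2_sum_type_eq_0[OF this eq del_delbar_form(3)[OF \<beta>1] del_delbar_form(4)[OF \<alpha>1]
      del_form_1_type(3,4)[OF \<alpha> \<beta>]]
  show thesis using that[OF \<alpha> z(2) \<beta> z(1)] eq z by simp
qed

abbreviation "Z01 \<equiv> {\<alpha> \<in> pq_forms \<A> 0 1. delbar \<alpha> = 0}"
abbreviation "N01 \<equiv> delbar ` forms \<A> 0"
abbreviation "Z10 \<equiv> {\<beta> \<in> pq_forms \<A> 1 0. del \<beta> = 0}"
abbreviation "N10 \<equiv> del ` forms \<A> 0"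
abbreviation "Z11 \<equiv> BC_cocycles \<A> \<theta>"
abbreviation "N11 \<equiv> BC_coboundaries \<A> \<theta>"
abbreviation "Z2 \<equiv> MN_cocycles \<A> \<theta>"
abbreviation "N2 \<equiv> MN_coboundaries \<A> \<theta>"

lemma pq_forms_subset:
  "pq_forms \<A> 0 1 \<subseteq> forms \<A> 1" "pq_forms \<A> 1 0 \<subseteq> forms \<A> 1" "pq_forms \<A> 1 1 \<subseteq> forms \<A> 2"
  unfolding pq_forms_0_1_iff pq_forms_1_0_iff pq_forms_1_1_iff subset_iff by blast+

lemma additive_on_cocycles:
  "additive_on delbar (pq_forms \<A> 0 1)" "additive_on del (pq_forms \<A> 0 1)"
  "additive_on delbar (pq_forms \<A> 1 0)" "additive_on del (pq_forms \<A> 1 0)"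
  "additive_on delbar (pq_forms \<A> 1 1)" "additive_on del (pq_forms \<A> 1 1)"
  using pq_forms_subset additive_on_del additive_on_delbar additive_on_subset by blast+

lemma add_subgroups:
  "add_subgroup Z01" "add_subgroup N01" "add_subgroup Z10" "add_subgroup N10"
  "add_subgroup Z11" "add_subgroup N11" "add_subgroup Z2" "add_subgroup N2"
proof -
  show "add_subgroup Z01" "add_subgroup Z10"
    by (intro add_subgroup_kernel add_subgroup_pq_forms additive_on_cocycles)+
  show n: "add_subgroup N01" and "add_subgroup N10"
    by (intro add_subgroup_image add_subgroup_forms additive_on_del additive_on_delbar)+
  \<comment> \<open>Two conditions are handled as a kernel within a kernel, so
    \<open>add_subgroup_kernel\<close> applies twice.\<close>
  have "BC_cocycles \<A> \<theta> = {\<eta> \<in> {\<eta> \<in> pq_forms \<A> 1 1. del \<eta> = 0}. delbar \<eta> = 0}"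
    by (auto simp: BC_cocycles_def)
  moreover have "additive_on delbar {\<eta> \<in> pq_forms \<A> 1 1. del \<eta> = 0}"
    using additive_on_cocycles(5) by (rule additive_on_subset) blast
  ultimately show "add_subgroup Z11"
    by (simp only:) (intro add_subgroup_kernel add_subgroup_pq_forms additive_on_cocycles)
  have "BC_coboundaries \<A> \<theta> = del ` N01"
    by (auto simp: BC_coboundaries_def)
  moreover have "additive_on del N01"
    using additive_on_del del_delbar_form(2) by (blast intro: additive_on_subset)
  ultimately show "add_subgroup N11"
    using add_subgroup_image[OF n] by metis
  show "add_subgroup Z2" "add_subgroup N2"
    unfolding MN_cocycles_def MN_coboundaries_def
    by (intro add_subgroup_kernel add_subgroup_image add_subgroup_forms additive_on_d)+
qed

lemma coboundary_subsets: "N01 \<subseteq> Z01" "N10 \<subseteq> Z10" "N11 \<subseteq> Z11" "N2 \<subseteq> Z2"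
proof -
  show "N01 \<subseteq> Z01" "N10 \<subseteq> Z10"
    using del_form_0_type del_del(1,2) by blast+
  show "N2 \<subseteq> Z2"
    unfolding MN_cocycles_def MN_coboundaries_def using del_delbar_form(5) del_del(3) by blast
  show "N11 \<subseteq> Z11"
    unfolding BC_coboundaries_def
  proof (rule image_subsetI)
    fix f assume f: "f \<in> forms \<A> 0"
    note g = del_delbar_form(2)[OF f]
    have "delbar (del (delbar f)) = - del (delbar (delbar f))" using del_del(4) g by blast
    also have "\<dots> = 0"
      using del_del(2)[of f] f additive_on_zero[OF additive_on_del forms_zero] by simp
    finally show "del (delbar f) \<in> Z11"
      using del_form_1_type(1)[OF del_form_0_type(2)[OF f] del_form_0_type(1)[OF f]] del_del(1) g
      by (simp add: BC_cocycles_def)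
  qed
qed

text \<open>For \<open>delbar \<alpha> = 0\<close>, anticommutation turns
  \<open>delbar (del \<alpha>)\<close> into \<open>- del 0\<close>, while
  \<open>del (del \<alpha>)\<close> is zero.\<close>

lemma del_maps_to: "del ` Z01 \<subseteq> Z11" "del ` N01 \<subseteq> N11"
proof -
  have "del 0 = 0" by (rule additive_on_zero[OF additive_on_del forms_zero])
  then show "del ` Z01 \<subseteq> Z11"
    \<comment> \<open>\<open>del_form_1_type\<close> treats a pair \<alpha>, \<beta> together; here
      the zero form fills the place of \<beta>.\<close>
    using del_form_1_type(1)[OF _ add_subgroup_pq_forms(1)[unfolded add_subgroup_def, THEN conjunct1]]
      del_del(1,4) pq_forms_subset(1)
    by (auto simp: BC_cocycles_def subset_iff)
  show "del ` N01 \<subseteq> N11" by (auto simp: BC_coboundaries_def)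
qed

lemma delbar_maps_to: "delbar ` Z10 \<subseteq> Z11" "delbar ` N10 \<subseteq> N11"
proof -
  have "delbar 0 = 0" "del 0 = 0"
    by (rule additive_on_zero[OF additive_on_delbar forms_zero] additive_on_zero[OF additive_on_del forms_zero])+
  moreover have "del (delbar \<beta>) = - delbar (del \<beta>)" if "\<beta> \<in> forms \<A> 1" for \<beta>
    using del_del(4)[of \<beta>] that by simp
  ultimately show "delbar ` Z10 \<subseteq> Z11"
    using del_form_1_type(2)[OF add_subgroup_pq_forms(2)[unfolded add_subgroup_def, THEN conjunct1]]
      del_del(2) pq_forms_subset(2)
    by (auto simp: BC_cocycles_def subset_iff)
  \<comment> \<open>Bott-Chern coboundaries are written with del outermost; the opposite order
    differs by a sign, which the subgroup \<open>N11\<close> absorbs.\<close>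
  have "delbar (del f) \<in> N11" if "f \<in> forms \<A> 0" for f
    using del_del(4)[of f] that add_subgroups(6) unfolding BC_coboundaries_def add_subgroup_def by simp
  then show "delbar ` N10 \<subseteq> N11" by blast
qed

text \<open>A form killed by del and delbar is killed by their sum. Since delbar squares to zero,
  \<open>del (delbar f)\<close> is \<open>d_theta\<close> of the 1-form
  \<open>delbar f\<close>.\<close>

lemma nu_maps_to: "Z11 \<subseteq> Z2" "N11 \<subseteq> N2"
proof -
  show "Z11 \<subseteq> Z2"
    using pq_forms_subset(3) by (auto simp: BC_cocycles_def MN_cocycles_def d_theta_eq)
  have "del (delbar f) = d_theta \<theta> (delbar f)" if "f \<in> forms \<A> 0" for f
    using that del_del(2) by (simp add: d_theta_eq)
  then show "N11 \<subseteq> N2"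
    unfolding BC_coboundaries_def MN_coboundaries_def using del_delbar_form(2) by blast
qed

lemma del_plus_delbar_coset:
  assumes "\<alpha> \<in> Z01" "\<beta> \<in> Z10"
  shows "del_plus_delbar \<A> \<theta> (coset N01 \<alpha>, coset N10 \<beta>) = coset N11 (del \<alpha> + delbar \<beta>)"
proof -
  have add: "additive_on del Z01" "additive_on delbar Z10"
    by (rule additive_on_subset[OF additive_on_cocycles(2)], blast)
      (rule additive_on_subset[OF additive_on_cocycles(3)], blast)
  have "induced_map Z11 N11 del (coset N01 \<alpha>) = coset N11 (del \<alpha>)"
    by (rule induced_map_coset[OF add(1) add_subgroups(2) coboundary_subsets(1) assms(1) add_subgroups(6) del_maps_to(2)])
  moreover have "induced_map Z11 N11 delbar (coset N10 \<beta>) = coset N11 (delbar \<beta>)"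
    by (rule induced_map_coset[OF add(2) add_subgroups(4) coboundary_subsets(2) assms(2) add_subgroups(6) delbar_maps_to(2)])
  ultimately show ?thesis
    unfolding del_plus_delbar_def prod.case H11_BC_def
    by (simp only: mult_form_group_Mod[OF add_subgroups(6)])
qed

lemma nu_coset:
  assumes "\<eta> \<in> Z11"
  shows "nu \<A> \<theta> (coset N11 \<eta>) = coset N2 \<eta>"
proof -
  have "additive_on (\<lambda>\<eta>. \<eta>) Z11" "(\<lambda>\<eta>. \<eta>) ` N11 \<subseteq> N2"
    using nu_maps_to(2) by (auto simp: additive_on_def)
  then show ?thesis
    unfolding nu_def
    using induced_map_coset[OF _ add_subgroups(6) coboundary_subsets(3) assms add_subgroups(8)] by blast
qed

lemma exact_sequence:
  "group_hom (H1_hol \<A> \<theta> \<times>\<times> H1_hol_conj \<A> \<theta>) (H11_BC \<A> \<theta>) (del_plus_delbar \<A> \<theta>)"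
  "group_hom (H11_BC \<A> \<theta>) (H2_MN \<A> \<theta>) (nu \<A> \<theta>)"
  "del_plus_delbar \<A> \<theta> ` carrier (H1_hol \<A> \<theta> \<times>\<times> H1_hol_conj \<A> \<theta>)
    = kernel (H11_BC \<A> \<theta>) (H2_MN \<A> \<theta>) (nu \<A> \<theta>)"
proof -
  note sg = add_subgroups and sub = coboundary_subsets
  have grp: "group (H1_hol \<A> \<theta>)" "group (H1_hol_conj \<A> \<theta>)" "group (H11_BC \<A> \<theta>)" "group (H2_MN \<A> \<theta>)"
    unfolding H1_hol_def H1_hol_conj_def H11_BC_def H2_MN_def
    by (intro group_form_group_Mod sg sub)+
  have carr: "carrier (H1_hol \<A> \<theta>) = coset N01 ` Z01" "carrier (H1_hol_conj \<A> \<theta>) = coset N10 ` Z10"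
    "carrier (H11_BC \<A> \<theta>) = coset N11 ` Z11" "carrier (H2_MN \<A> \<theta>) = coset N2 ` Z2"
    unfolding H1_hol_def H1_hol_conj_def H11_BC_def H2_MN_def by (rule carrier_form_group_Mod)+
  have mult: "coset N01 z \<otimes>\<^bsub>H1_hol \<A> \<theta>\<^esub> coset N01 w = coset N01 (z + w)"
    "coset N10 z \<otimes>\<^bsub>H1_hol_conj \<A> \<theta>\<^esub> coset N10 w = coset N10 (z + w)"
    "coset N11 z \<otimes>\<^bsub>H11_BC \<A> \<theta>\<^esub> coset N11 w = coset N11 (z + w)"
    "coset N2 z \<otimes>\<^bsub>H2_MN \<A> \<theta>\<^esub> coset N2 w = coset N2 (z + w)" for z w
    unfolding H1_hol_def H1_hol_conj_def H11_BC_def H2_MN_def by (intro mult_form_group_Mod sg)+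
  have Z11: "del \<alpha> + delbar \<beta> \<in> Z11" if "\<alpha> \<in> Z01" "\<beta> \<in> Z10" for \<alpha> \<beta>
    using that del_maps_to(1) delbar_maps_to(1) sg(5) unfolding add_subgroup_def by blast
  show "group_hom (H1_hol \<A> \<theta> \<times>\<times> H1_hol_conj \<A> \<theta>) (H11_BC \<A> \<theta>) (del_plus_delbar \<A> \<theta>)"
  proof (intro group_hom.intro group_hom_axioms.intro DirProd_group grp homI)
    fix u assume "u \<in> carrier (H1_hol \<A> \<theta> \<times>\<times> H1_hol_conj \<A> \<theta>)"
    then obtain \<alpha> \<beta> where u: "\<alpha> \<in> Z01" "\<beta> \<in> Z10" "u = (coset N01 \<alpha>, coset N10 \<beta>)"
      unfolding DirProd_def by (auto simp: carr)
    show "del_plus_delbar \<A> \<theta> u \<in> carrier (H11_BC \<A> \<theta>)"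
      unfolding u(3) del_plus_delbar_coset[OF u(1,2)] carr using Z11[OF u(1,2)] by blast
    fix v assume "v \<in> carrier (H1_hol \<A> \<theta> \<times>\<times> H1_hol_conj \<A> \<theta>)"
    then obtain \<alpha>' \<beta>' where v: "\<alpha>' \<in> Z01" "\<beta>' \<in> Z10" "v = (coset N01 \<alpha>', coset N10 \<beta>')"
      unfolding DirProd_def by (auto simp: carr)
    have s: "\<alpha> + \<alpha>' \<in> Z01" "\<beta> + \<beta>' \<in> Z10"
      using sg(1,3) u v unfolding add_subgroup_def by blast+
    have "del (\<alpha> + \<alpha>') = del \<alpha> + del \<alpha>'" "delbar (\<beta> + \<beta>') = delbar \<beta> + delbar \<beta>'"
      using additive_on_cocycles(2,3) u v unfolding additive_on_def by blast+
    then show "del_plus_delbar \<A> \<theta> (u \<otimes>\<^bsub>H1_hol \<A> \<theta> \<times>\<times> H1_hol_conj \<A> \<theta>\<^esub> v) =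
        del_plus_delbar \<A> \<theta> u \<otimes>\<^bsub>H11_BC \<A> \<theta>\<^esub> del_plus_delbar \<A> \<theta> v"
      unfolding u(3) v(3) mult_DirProd mult del_plus_delbar_coset[OF u(1,2)] del_plus_delbar_coset[OF v(1,2)]
        del_plus_delbar_coset[OF s] by (simp only: ac_simps)
  qed
  show "group_hom (H11_BC \<A> \<theta>) (H2_MN \<A> \<theta>) (nu \<A> \<theta>)"
  proof (intro group_hom.intro group_hom_axioms.intro grp homI)
    fix u assume "u \<in> carrier (H11_BC \<A> \<theta>)"
    then obtain \<eta> where u: "\<eta> \<in> Z11" "u = coset N11 \<eta>" unfolding carr by blast
    show "nu \<A> \<theta> u \<in> carrier (H2_MN \<A> \<theta>)"
      unfolding u(2) nu_coset[OF u(1)] carr using nu_maps_to(1) u(1) by blast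
    fix v assume "v \<in> carrier (H11_BC \<A> \<theta>)"
    then obtain \<eta>' where v: "\<eta>' \<in> Z11" "v = coset N11 \<eta>'" unfolding carr by blast
    have s: "\<eta> + \<eta>' \<in> Z11" using sg(5) u v unfolding add_subgroup_def by blast
    show "nu \<A> \<theta> (u \<otimes>\<^bsub>H11_BC \<A> \<theta>\<^esub> v) = nu \<A> \<theta> u \<otimes>\<^bsub>H2_MN \<A> \<theta>\<^esub> nu \<A> \<theta> v"
      unfolding u(2) v(2) mult nu_coset[OF u(1)] nu_coset[OF v(1)] nu_coset[OF s] ..
  qed
  have "del_plus_delbar \<A> \<theta> ` carrier (H1_hol \<A> \<theta> \<times>\<times> H1_hol_conj \<A> \<theta>) =
      {coset N11 (del \<alpha> + delbar \<beta>) | \<alpha> \<beta>. \<alpha> \<in> Z01 \<and> \<beta> \<in> Z10}" (is "_ = ?im")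
  proof (intro equalityI subsetI)
    fix k assume "k \<in> del_plus_delbar \<A> \<theta> ` carrier (H1_hol \<A> \<theta> \<times>\<times> H1_hol_conj \<A> \<theta>)"
    then obtain \<alpha> \<beta> where ab: "\<alpha> \<in> Z01" "\<beta> \<in> Z10"
      and "k = del_plus_delbar \<A> \<theta> (coset N01 \<alpha>, coset N10 \<beta>)"
      unfolding DirProd_def by (auto simp: carr)
    then show "k \<in> ?im" unfolding del_plus_delbar_coset[OF ab] by blast
  next
    fix k assume "k \<in> ?im"
    then obtain \<alpha> \<beta> where ab: "\<alpha> \<in> Z01" "\<beta> \<in> Z10" and k: "k = coset N11 (del \<alpha> + delbar \<beta>)" by blast
    show "k \<in> del_plus_delbar \<A> \<theta> ` carrier (H1_hol \<A> \<theta> \<times>\<times> H1_hol_conj \<A> \<theta>)"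
      unfolding k del_plus_delbar_coset[OF ab, symmetric]
      by (rule imageI, simp only: DirProd_def partial_object.simps carr) (use ab in blast)
  qed
  also have "\<dots> = kernel (H11_BC \<A> \<theta>) (H2_MN \<A> \<theta>) (nu \<A> \<theta>)"
  proof (intro equalityI subsetI)
    fix k assume "k \<in> ?im"
    then obtain \<alpha> \<beta> where ab: "\<alpha> \<in> Z01" "\<beta> \<in> Z10" and k: "k = coset N11 (del \<alpha> + delbar \<beta>)" by blast
    have ab1: "\<alpha> \<in> forms \<A> 1" "\<beta> \<in> forms \<A> 1" using ab pq_forms_subset by blast+
    have "d_theta \<theta> (\<alpha> + \<beta>) = d_theta \<theta> \<alpha> + d_theta \<theta> \<beta>"
      using additive_on_d ab1 unfolding additive_on_def by blast
    \<comment> \<open>The other two terms, \<open>delbar \<alpha>\<close> and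
      \<open>del \<beta>\<close>, vanish by the cocycle conditions; so the image lies in the
      kernel.\<close>
    then have "del \<alpha> + delbar \<beta> = d_theta \<theta> (\<alpha> + \<beta>)" using ab by (simp add: d_theta_eq)
    \<comment> \<open>The difference with 0 is what \<open>coset_eq_iff\<close> asks for when a
      class is compared with the identity \<open>coset N2 0\<close>.\<close>
    then have "del \<alpha> + delbar \<beta> - 0 \<in> N2"
      using forms_add[OF ab1] by (simp add: MN_coboundaries_def)
    then have "nu \<A> \<theta> k = \<one>\<^bsub>H2_MN \<A> \<theta>\<^esub>"
      unfolding k nu_coset[OF Z11[OF ab]] H2_MN_def one_form_group_Mod by (rule coset_eq_iff[OF sg(8), THEN iffD2])
    then show "k \<in> kernel (H11_BC \<A> \<theta>) (H2_MN \<A> \<theta>) (nu \<A> \<theta>)"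
      unfolding kernel_def carr using k Z11[OF ab] by blast
  next
    fix k assume "k \<in> kernel (H11_BC \<A> \<theta>) (H2_MN \<A> \<theta>) (nu \<A> \<theta>)"
    then obtain \<eta> where \<eta>: "\<eta> \<in> Z11" and k: "k = coset N11 \<eta>" and "nu \<A> \<theta> k = \<one>\<^bsub>H2_MN \<A> \<theta>\<^esub>"
      unfolding kernel_def carr by blast
    then have "coset N2 \<eta> = coset N2 0"
      unfolding k nu_coset[OF \<eta>] H2_MN_def one_form_group_Mod by simp
    then have "\<eta> - 0 \<in> N2" by (rule coset_eq_iff[OF sg(8), THEN iffD1])
    then obtain \<gamma> where \<gamma>: "\<gamma> \<in> forms \<A> 1" "\<eta> = d_theta \<theta> \<gamma>"
      unfolding MN_coboundaries_def by auto
    have "\<eta> \<in> pq_forms \<A> 1 1" using \<eta> by (simp add: BC_cocycles_def)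
    then obtain \<alpha> \<beta> where "\<alpha> \<in> pq_forms \<A> 0 1" "delbar \<alpha> = 0" "\<beta> \<in> pq_forms \<A> 1 0" "del \<beta> = 0"
      "\<eta> = del \<alpha> + delbar \<beta>"
      by (rule exact_1_1_decompose[OF _ \<gamma>(2,1)])
    then show "k \<in> ?im" unfolding k by blast
  qed
  finally show "del_plus_delbar \<A> \<theta> ` carrier (H1_hol \<A> \<theta> \<times>\<times> H1_hol_conj \<A> \<theta>)
    = kernel (H11_BC \<A> \<theta>) (H2_MN \<A> \<theta>) (nu \<A> \<theta>)" .
qed

end

text \<open>The arrows are defined by unions of cosets, so the two \<open>group_hom\<close> clauses
  also assert, by landing in the carriers, that the arrows are well defined on classes. Exactness is
  the equality of image and kernel.\<close>

theorem theorem4p7: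
  fixes X :: "'a topology" and \<A> :: "('a, 'n::finite) chart set" and \<theta> :: "('a, 'n) form"
  assumes "complex_manifold X \<A>"
    and "\<theta> \<in> forms \<A> 1"
    and "\<And>c x vs. \<theta> c x vs \<in> \<real>"
    and "ext_d \<theta> = 0"
  shows "group_hom (H1_hol \<A> \<theta> \<times>\<times> H1_hol_conj \<A> \<theta>) (H11_BC \<A> \<theta>) (del_plus_delbar \<A> \<theta>) \<and>
         group_hom (H11_BC \<A> \<theta>) (H2_MN \<A> \<theta>) (nu \<A> \<theta>) \<and>
         del_plus_delbar \<A> \<theta> ` carrier (H1_hol \<A> \<theta> \<times>\<times> H1_hol_conj \<A> \<theta>)
           = kernel (H11_BC \<A> \<theta>) (H2_MN \<A> \<theta>) (nu \<A> \<theta>)"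
proof -
  interpret flat_line_bundle X \<A> \<theta>
    using assms by unfold_locales
  show ?thesis using exact_sequence by blast
qed

end
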